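(* Let $s>\frac12$, and let $u\in H^s_s(\mathbb{R})$ be real-valued. Let $\alpha\in(0,\frac\pi2)$ and let $k$ range over the complex numbers with $|\mathrm{Im}\,k|>(\tan\alpha)\,\mathrm{Re}\,k$. Let $m_1(x,k)$ be the Jost solution. Then there exists $\epsilon>0$ such that $$m_1(x,k)=1-\frac{C_+u(x)}{k}+O\Big(\frac1{|k|^{1+\epsilon}}\Big)\quad\text{as }k\to\infty$$ (within this set of $k$), where the $O$ term is in the sense of the $L^\infty(\mathbb{R})$ norm in $x$.
   Context: Notation. $w(x)=1+|x|$; $L^p_s(\mathbb{R})=\{f: w^sf\in L^p(\mathbb{R})\}$ with norm $\|w^sf\|_p$; $\hat f(\xi)=\int e^{-i\xi x}f(x)\,dx$; $H^s_s(\mathbb{R})=\{f: f\in L^2_s(\mathbb{R})\text{ and }\hat f\in L^2_s(\mathbb{R})\}$. $C_+$ is the Cauchy projection $\widehat{C_+f}=\chi_{(0,\infty)}\hat f$. For $k\in\mathbb{C}\setminus[0,\infty)$ let $G_k(x)=\frac1{2\pi}\int_0^\infty\frac{e^{ix\xi}}{\xi-k}d\xi$. With any fixed $s_1\in(\frac12,s)$, the Jost solution $m_1(\cdot,k)$ is the unique function in $L^\infty_{-(s-s_1)}(\mathbb{R})$ with $m_1(\cdot,k)=1+G_k*(u\,m_1(\cdot,k))$; it is known to exist for $|k|$ sufficiently large. *)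

theory Defs
  imports "HOL-Probability.Essential_Supremum"
begin

text \<open>
  Elements of the function spaces are represented by Lebesgue measurable functions;
  all conditions below are invariant under changes on null sets.
\<close>

definition weight :: "real \<Rightarrow> real" where
  "weight x = 1 + \<bar>x\<bar>"

definition L2_weighted :: "real \<Rightarrow> (real \<Rightarrow> complex) set" where
  "L2_weighted s = {f \<in> borel_measurable lebesgue.
     integrable lebesgue (\<lambda>x. (cmod (weight x powr s *\<^sub>R f x))\<^sup>2)}"

definition Linf_norm :: "(real \<Rightarrow> complex) \<Rightarrow> ereal" where
  "Linf_norm f = esssup lebesgue (\<lambda>x. ereal (cmod (f x)))"

definition Linf_weighted :: "real \<Rightarrow> (real \<Rightarrow> complex) set" where
  "Linf_weighted s = {f \<in> borel_measurable lebesgue.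
     Linf_norm (\<lambda>x. weight x powr s *\<^sub>R f x) < \<infinity>}"

definition fourier :: "(real \<Rightarrow> complex) \<Rightarrow> real \<Rightarrow> complex" where
  "fourier f \<xi> = (LINT x|lebesgue. exp (- (\<i> * of_real \<xi> * of_real x)) * f x)"

definition inverse_fourier :: "(real \<Rightarrow> complex) \<Rightarrow> real \<Rightarrow> complex" where
  "inverse_fourier g x =
     1 / (2 * of_real pi) * (LINT \<xi>|lebesgue. exp (\<i> * of_real x * of_real \<xi>) * g \<xi>)"

text \<open>
  The Fourier transform is the absolutely convergent integral.  This agrees with the
  Fourier transform on \<open>L\<^sup>2\<close> only on integrable functions, so the next two definitions are
  meaningful for \<open>s > 1/2\<close>: then \<open>L2_weighted s\<close> consists of integrable functions by the
  Cauchy-Schwarz inequality, and both \<open>f\<close> and \<open>fourier f\<close> are integrable for \<open>f\<close> in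
  \<open>Hss s\<close>.
\<close>

definition Hss :: "real \<Rightarrow> (real \<Rightarrow> complex) set" where
  "Hss s = {f. f \<in> L2_weighted s \<and> fourier f \<in> L2_weighted s}"

definition cauchy_plus :: "(real \<Rightarrow> complex) \<Rightarrow> real \<Rightarrow> complex" where
  "cauchy_plus f = inverse_fourier (\<lambda>\<xi>. indicator {0<..} \<xi> * fourier f \<xi>)"

text \<open>
  The integral over \<open>(0, \<infinity>)\<close> defining \<open>G\<^sub>k(x)\<close> is only conditionally convergent
  for \<open>x \<noteq> 0\<close>, so it is an improper integral.  It diverges at \<open>x = 0\<close>, where the value
  is irrelevant because \<open>G\<^sub>k\<close> enters only through convolution.
\<close>

definition G :: "complex \<Rightarrow> real \<Rightarrow> complex" where
  "G k x = 1 / (2 * of_real pi) *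
     Lim at_top (\<lambda>R. LINT \<xi>:{0..R}|lebesgue.
       exp (\<i> * of_real x * of_real \<xi>) / (of_real \<xi> - k))"

definition convolution :: "(real \<Rightarrow> complex) \<Rightarrow> (real \<Rightarrow> complex) \<Rightarrow> real \<Rightarrow> complex" where
  "convolution f g x = (LINT y|lebesgue. f (x - y) * g y)"

definition is_jost_solution ::
    "real \<Rightarrow> real \<Rightarrow> (real \<Rightarrow> complex) \<Rightarrow> complex \<Rightarrow> (real \<Rightarrow> complex) \<Rightarrow> bool" where
  "is_jost_solution s s1 u k m \<longleftrightarrow>
     m \<in> Linf_weighted (- (s - s1)) \<and>
     (AE x in lebesgue. m x = 1 + convolution (G k) (\<lambda>y. u y * m y) x)"

text \<open>
  The Jost solution is unique as an element of a space of functions modulo null sets,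
  so a representative is chosen.
\<close>

definition jost_m1 ::
    "real \<Rightarrow> real \<Rightarrow> (real \<Rightarrow> complex) \<Rightarrow> real \<Rightarrow> complex \<Rightarrow> complex" where
  "jost_m1 s s1 u x k =
     (SOME m. is_jost_solution s s1 u k m \<and>
        (\<forall>m'. is_jost_solution s s1 u k m' \<longrightarrow> (AE y in lebesgue. m' y = m y))) x"

end

theory Submission
  imports Defs
begin

text \<open>
  In the sector \<open>\<bar>\<xi> - k\<bar> \<ge> c (\<xi> + \<bar>k\<bar>)\<close> for \<open>\<xi> \<ge> 0\<close>, which gives
  \<open>\<bar>G\<^sub>k(x)\<bar> \<le> C (\<bar>k\<bar> \<bar>x\<bar>) powr (-1/4)\<close>.  Hence, with \<open>\<delta> = s - s1\<close>, the operator \<open>T m = G\<^sub>k * (v m)\<close>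
  maps \<open>Linf_weighted (- \<delta>)\<close> into bounded functions with norm \<open>O(\<bar>k\<bar> powr (-1/4))\<close>; for large \<open>\<bar>k\<bar>\<close>
  it is a contraction, the Jost solution exists, is unique and bounded.  On the Fourier side
  \<open>T 1\<close> is the multiplier \<open>1 / (\<xi> - k)\<close> on \<open>(0, \<infinity>)\<close>, so \<open>T 1 = O(1 / \<bar>k\<bar>)\<close>, and since
  \<open>1 / (\<xi> - k) + 1 / k = \<xi> / (k (\<xi> - k))\<close> the error \<open>T 1 + C\<^sub>+ v / k\<close> is
  \<open>O(\<bar>k\<bar> powr (-1 - \<epsilon>))\<close> whenever \<open>\<bar>\<xi>\<bar> powr \<epsilon> * fourier v\<close> is integrable.  Finally
  \<open>m - 1 = T 1 + T (m - 1)\<close> shows first \<open>m - 1 = O(1 / \<bar>k\<bar>)\<close> and then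
  \<open>T (m - 1) = O(\<bar>k\<bar> powr (-5/4))\<close>.
\<close>

section \<open>The kernel in a sector\<close>

text \<open>With \<open>r = t powr (1/4)\<close> the binomial expansion gives
  \<open>1 + r ^ 4 \<le> (1 + r) ^ 4\<close>, and taking logarithms finishes. The exponent 1/4 is
  small enough that the square of a \<open>\<bar>x\<bar> powr (-1/4)\<close> singularity stays
  locally integrable.\<close>

lemma ln_add_one_le_powr:
  fixes t :: real
  assumes "0 \<le> t"
  shows "ln (1 + t) \<le> 4 * t powr (1/4)"
proof -
  have p: "(t powr (1/4)) ^ 4 = t"
    using assms by (cases "t = 0") (auto simp: powr_powr simp flip: powr_realpow)
  define r where "r = t powr (1/4)"
  have r: "0 \<le> r" "t = r ^ 4" using p by (auto simp: r_def)
  have "1 + t \<le> (1 + r) ^ 4"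
    using r(1) unfolding r(2) by (simp add: power4_eq_xxxx algebra_simps)
  then have "ln (1 + t) \<le> ln ((1 + r) ^ 4)"
    using assms by (intro ln_mono) auto
  also have "\<dots> = 4 * ln (1 + r)" using r(1) by (simp add: ln_realpow)
  also have "\<dots> \<le> 4 * r" using r(1) ln_add_one_self_le_self by simp
  finally show ?thesis by (simp add: r_def)
qed

lemma inverse_one_add_le_powr:
  fixes q :: real
  assumes "0 < q"
  shows "1 / (1 + q) \<le> q powr (-1/4)"
proof -
  have "q powr (1/4) \<le> (1 + q) powr (1/4)" using assms by (intro powr_mono2) auto
  also have "\<dots> \<le> (1 + q) powr 1" using assms by (intro powr_mono) auto
  finally have "q powr (1/4) \<le> 1 + q" using assms by simp
  then show ?thesis using assms by (simp add: powr_minus_divide frac_le)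
qed

text \<open>For \<open>Re k \<le> 0\<close> both \<xi> and \<open>cmod k\<close> are at most the
  distance d from \<xi> to k. Otherwise the sector condition gives
  \<open>Re k \<le> \<bar>Im k\<bar> / t \<le> d / t\<close>, which controls \<xi> and
  \<open>cmod k\<close> through the real and imaginary parts of \<xi> - k.\<close>

lemma sector_resolvent_bound:
  fixes k :: complex and t \<xi> :: real
  assumes "0 < t" "t * Re k < \<bar>Im k\<bar>" "0 \<le> \<xi>"
  shows "\<xi> + cmod k \<le> (3 + 2 / t) * cmod (of_real \<xi> - k)"
proof (cases "Re k \<le> 0")
  case True
  have "\<xi> \<le> \<bar>Re (of_real \<xi> - k)\<bar>" using True by simp
  then have 1: "\<xi> \<le> cmod (of_real \<xi> - k)" using abs_Re_le_cmod order_trans by blast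
  have "(Re k)\<^sup>2 \<le> (\<xi> - Re k)\<^sup>2"
    using True assms(3) by (simp add: abs_le_square_iff[symmetric])
  then have 2: "cmod k \<le> cmod (of_real \<xi> - k)"
    by (simp add: cmod_def)
  have "2 * cmod (of_real \<xi> - k) \<le> (3 + 2 / t) * cmod (of_real \<xi> - k)"
    using assms(1) by (intro mult_right_mono) auto
  with 1 2 show ?thesis by linarith
next
  case False
  define d where "d = cmod (of_real \<xi> - k)"
  have b: "\<bar>Im k\<bar> \<le> d" using abs_Im_le_cmod[of "of_real \<xi> - k"] by (simp add: d_def)
  have "Re k \<le> \<bar>Im k\<bar> / t" using assms by (simp add: field_simps)
  then have r: "Re k \<le> d / t" using b assms(1) by (smt (verit) divide_right_mono)
  have "cmod k \<le> \<bar>Re k\<bar> + \<bar>Im k\<bar>" by (rule cmod_le)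
  then have k: "cmod k \<le> d / t + d" using r b False by linarith
  have "\<xi> - Re k \<le> d" using abs_Re_le_cmod[of "of_real \<xi> - k"] by (simp add: d_def)
  then have "\<xi> + cmod k \<le> 2 * d + 2 * (d / t)" using k r by linarith
  also have "\<dots> \<le> (3 + 2 / t) * d" using assms(1) by (simp add: field_simps d_def)
  finally show ?thesis by (simp add: d_def)
qed

text \<open>The truncations of the improper integral in \<open>G\<close>, without the factor 1/(2
  pi). Fubini applies to them, whereas the limiting integral converges only conditionally.\<close>

definition partial_kernel :: "complex \<Rightarrow> real \<Rightarrow> real \<Rightarrow> complex" where
  "partial_kernel k R x =
     (LINT \<xi>:{0..R}|lebesgue. exp (\<i> * of_real x * of_real \<xi>) / (of_real \<xi> - k))"

text \<open>The geometry of the sector enters through this inequality alone. L is independent of k,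
  so the estimates below are uniform over the sector.\<close>

locale resolvent_bound =
  fixes k :: complex and L :: real
  assumes k_nz: "k \<noteq> 0"
    and L_ge_1: "1 \<le> L"
    and bound: "0 \<le> \<xi> \<Longrightarrow> \<xi> + cmod k \<le> L * cmod (of_real \<xi> - k)"
begin

lemma L_nonneg: "0 \<le> L"
  using L_ge_1 by simp

lemma diff_nz: "0 \<le> \<xi> \<Longrightarrow> of_real \<xi> - k \<noteq> 0"
proof
  assume "0 \<le> \<xi>" "of_real \<xi> - k = 0"
  then show False using bound[of \<xi>] k_nz norm_ge_zero[of k]
    by (metis add_nonneg_eq_0_iff antisym mult_zero_right norm_eq_zero norm_zero add_nonneg_nonneg)
qed

lemma norm_inverse_le:
  assumes "0 \<le> \<xi>"
  shows "1 / cmod (of_real \<xi> - k) \<le> L / (\<xi> + cmod k)"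
proof -
  have "0 < cmod (of_real \<xi> - k)" "0 < \<xi> + cmod k"
    using diff_nz[OF assms] k_nz assms by (auto simp: add_nonneg_pos)
  then show ?thesis using bound[OF assms] by (simp add: field_simps)
qed

lemma continuous_on_integrand:
  "continuous_on {0..} (\<lambda>\<xi>. exp (\<i> * of_real x * of_real \<xi>) / (of_real \<xi> - k))"
  using diff_nz by (intro continuous_intros) auto

lemma integrand_integrable_on:
  "0 \<le> a \<Longrightarrow> (\<lambda>\<xi>. exp (\<i> * of_real x * of_real \<xi>) / (of_real \<xi> - k)) integrable_on {a..b}"
  by (intro integrable_continuous_real continuous_on_subset[OF continuous_on_integrand]) auto

lemma partial_kernel_eq_integral:
  "partial_kernel k R x = integral {0..R} (\<lambda>\<xi>. exp (\<i> * of_real x * of_real \<xi>) / (of_real \<xi> - k))"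
  unfolding partial_kernel_def
proof (rule set_lebesgue_integral_eq_integral(2))
  have "continuous_on {0..R} (\<lambda>\<xi>. exp (\<i> * of_real x * of_real \<xi>) / (of_real \<xi> - k))"
    by (rule continuous_on_subset[OF continuous_on_integrand]) auto
  from absolutely_integrable_continuous_real[OF this]
  show "set_integrable lebesgue {0..R} (\<lambda>\<xi>. exp (\<i> * of_real x * of_real \<xi>) / (of_real \<xi> - k))" .
qed

text \<open>Oscillation is ignored here: the integrand is majorized by
  \<open>L / (\<xi> + cmod k)\<close>, whose primitive is a logarithm. This suffices for frequencies
  up to \<open>1 / \<bar>x\<bar>\<close>.\<close>

lemma norm_integral_low_le:
  assumes "0 \<le> R"
  shows "cmod (integral {0..R} (\<lambda>\<xi>. exp (\<i> * of_real x * of_real \<xi>) / (of_real \<xi> - k)))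
    \<le> L * ln (1 + R / cmod k)"
proof -
  have "((\<lambda>\<xi>. L / (\<xi> + cmod k)) has_integral (L * ln (R + cmod k) - L * ln (0 + cmod k))) {0..R}"
    using assms k_nz
    by (intro fundamental_theorem_of_calculus)
      (auto intro!: derivative_eq_intros simp flip: has_real_derivative_iff_has_vector_derivative
        simp: add_nonneg_pos)
  also have "L * ln (R + cmod k) - L * ln (0 + cmod k) = L * ln (1 + R / cmod k)"
  proof -
    have "ln (1 + R / cmod k) = ln ((R + cmod k) / cmod k)" using k_nz by (simp add: field_simps)
    also have "\<dots> = ln (R + cmod k) - ln (cmod k)"
      using k_nz assms by (intro ln_divide_pos) (auto simp: add_nonneg_pos)
    finally show ?thesis by (simp only: right_diff_distrib add_0_left)
  qed
  finally have I: "((\<lambda>\<xi>. L / (\<xi> + cmod k)) has_integral (L * ln (1 + R / cmod k))) {0..R}" .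
  have "cmod (integral {0..R} (\<lambda>\<xi>. exp (\<i> * of_real x * of_real \<xi>) / (of_real \<xi> - k)))
      \<le> integral {0..R} (\<lambda>\<xi>. L / (\<xi> + cmod k))"
    using I norm_inverse_le
    by (intro integral_norm_bound_integral integrand_integrable_on)
      (auto simp: norm_divide norm_exp_i_times mult.assoc simp flip: of_real_mult)
  with I show ?thesis by (simp add: integral_unique)
qed

text \<open>The decay in \<open>x\<close> comes from integrating the oscillating factor by parts.\<close>

lemma norm_integral_tail_le:
  assumes "0 \<le> a" "a \<le> R" "x \<noteq> 0"
  shows "cmod (integral {a..R} (\<lambda>\<xi>. exp (\<i> * of_real x * of_real \<xi>) / (of_real \<xi> - k)))
    \<le> 3 * L\<^sup>2 / (\<bar>x\<bar> * (a + cmod k))"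
proof -
  define e where "e = (\<lambda>\<xi>. exp (\<i> * of_real x * of_real \<xi>))"
  have ne: "cmod (e \<xi>) = 1" for \<xi> by (simp add: e_def mult.assoc norm_exp_i_times flip: of_real_mult)
  \<comment> \<open>F is the boundary term of the integration by parts: its derivative is the
    integrand minus a remainder that decays like the inverse square of \<xi>.\<close>
  define F where "F = (\<lambda>\<xi>. e \<xi> / (\<i> * of_real x * (of_real \<xi> - k)))"
  have hint: "((\<lambda>\<xi>. e \<xi> / (of_real \<xi> - k) - e \<xi> / (\<i> * of_real x * (of_real \<xi> - k)\<^sup>2))
      has_integral (F R - F a)) {a..R}"
  proof (rule fundamental_theorem_of_calculus[OF assms(2)])
    fix \<xi> assume "\<xi> \<in> {a..R}"
    then have nz: "of_real \<xi> - k \<noteq> 0" using diff_nz assms by auto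
    \<comment> \<open>With \<open>c = \<i> * of_real x\<close> and
      \<open>d = of_real \<xi> - k\<close> this brings the derivative into the form produced by the
      quotient rule.\<close>
    have alg: "(y * c * (c * d) - y * c) / (c * d * (c * d)) = y / d - y / (c * d\<^sup>2)"
      if "c \<noteq> 0" "d \<noteq> 0" for y c d :: complex
      using that by (simp add: divide_simps power2_eq_square) (simp add: algebra_simps)
    have "((\<lambda>z. exp (\<i> * of_real x * z) / (\<i> * of_real x * (z - k))) has_field_derivative
       (e \<xi> / (of_real \<xi> - k) - e \<xi> / (\<i> * of_real x * (of_real \<xi> - k)\<^sup>2))) (at (of_real \<xi>))"
      using nz assms(3) unfolding e_def
      by (subst alg[symmetric]) (auto intro!: derivative_eq_intros)
    from has_vector_derivative_real_field[OF this]
    show "(F has_vector_derivative (e \<xi> / (of_real \<xi> - k) - e \<xi> / (\<i> * of_real x * (of_real \<xi> - k)\<^sup>2)))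
       (at \<xi> within {a..R})"
      unfolding F_def e_def by (simp add: o_def)
  qed
  have i1: "(\<lambda>\<xi>. e \<xi> / (of_real \<xi> - k)) integrable_on {a..R}"
    unfolding e_def by (rule integrand_integrable_on[OF assms(1)])
  have i2: "(\<lambda>\<xi>. e \<xi> / (\<i> * of_real x * (of_real \<xi> - k)\<^sup>2)) integrable_on {a..R}"
    unfolding e_def using diff_nz assms
    by (intro integrable_continuous_real continuous_intros) auto
  have eq: "integral {a..R} (\<lambda>\<xi>. e \<xi> / (of_real \<xi> - k))
     = F R - F a + integral {a..R} (\<lambda>\<xi>. e \<xi> / (\<i> * of_real x * (of_real \<xi> - k)\<^sup>2))"
    using integral_unique[OF hint] integral_diff[OF i1 i2] by (simp only: diff_eq_eq)
  define b where "b = 1 / (\<bar>x\<bar> * (a + cmod k))"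
  have ak: "0 < a + cmod k" using assms k_nz by (simp add: add_nonneg_pos)
  have bnn: "0 \<le> b" using ak assms by (simp add: b_def)
  have Fb: "cmod (F \<xi>) \<le> L * b" if "a \<le> \<xi>" for \<xi>
  proof -
    have "cmod (F \<xi>) = 1 / cmod (of_real \<xi> - k) / \<bar>x\<bar>"
      by (simp add: F_def norm_divide norm_mult ne)
    also have "\<dots> \<le> L / (\<xi> + cmod k) / \<bar>x\<bar>"
      using that assms by (intro divide_right_mono norm_inverse_le) auto
    also have "\<dots> \<le> L / (a + cmod k) / \<bar>x\<bar>"
      using that assms ak L_nonneg by (intro divide_right_mono divide_left_mono mult_pos_pos) auto
    finally show ?thesis by (simp add: b_def mult.commute)
  qed
  have I: "((\<lambda>\<xi>. L\<^sup>2 / \<bar>x\<bar> * (1 / (\<xi> + cmod k)\<^sup>2)) has_integral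
      L\<^sup>2 / \<bar>x\<bar> * (- 1 / (R + cmod k) - - 1 / (a + cmod k))) {a..R}"
  proof (intro has_integral_mult_right fundamental_theorem_of_calculus assms)
    fix \<xi> assume "\<xi> \<in> {a..R}"
    then have "\<xi> + cmod k \<noteq> 0" using ak by auto
    then show "((\<lambda>\<xi>. - 1 / (\<xi> + cmod k)) has_vector_derivative 1 / (\<xi> + cmod k)\<^sup>2) (at \<xi> within {a..R})"
      by (auto intro!: derivative_eq_intros simp: power2_eq_square
         simp flip: has_real_derivative_iff_has_vector_derivative)
  qed
  have "cmod (integral {a..R} (\<lambda>\<xi>. e \<xi> / (\<i> * of_real x * (of_real \<xi> - k)\<^sup>2)))
     \<le> integral {a..R} (\<lambda>\<xi>. L\<^sup>2 / \<bar>x\<bar> * (1 / (\<xi> + cmod k)\<^sup>2))"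
  proof (rule integral_norm_bound_integral[OF i2])
    show "(\<lambda>\<xi>. L\<^sup>2 / \<bar>x\<bar> * (1 / (\<xi> + cmod k)\<^sup>2)) integrable_on {a..R}" using I by blast
    fix \<xi> assume "\<xi> \<in> {a..R}"
    then have "(1 / cmod (of_real \<xi> - k))\<^sup>2 \<le> (L / (\<xi> + cmod k))\<^sup>2"
      using assms by (intro power_mono norm_inverse_le) auto
    then have "(1 / cmod (of_real \<xi> - k))\<^sup>2 / \<bar>x\<bar> \<le> (L / (\<xi> + cmod k))\<^sup>2 / \<bar>x\<bar>"
      by (intro divide_right_mono) auto
    then show "cmod (e \<xi> / (\<i> * of_real x * (of_real \<xi> - k)\<^sup>2)) \<le> L\<^sup>2 / \<bar>x\<bar> * (1 / (\<xi> + cmod k)\<^sup>2)"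
      by (simp add: norm_divide norm_mult ne norm_power power_divide mult.commute)
  qed
  also have "\<dots> = L\<^sup>2 / \<bar>x\<bar> * (1 / (a + cmod k) - 1 / (R + cmod k))"
    using integral_unique[OF I] by simp
  also have "\<dots> \<le> L\<^sup>2 / \<bar>x\<bar> * (1 / (a + cmod k))"
    using ak assms by (intro mult_left_mono) auto
  also have "\<dots> = L * b * L" by (simp add: b_def power2_eq_square)
  \<comment> \<open>The two boundary values contribute \<open>L * b\<close> each and the remainder
    \<open>L\<^sup>2 * b\<close>; since L is at least 1, all three fit into
    \<open>3 * L\<^sup>2 * b\<close>.\<close>
  finally have "cmod (integral {a..R} (\<lambda>\<xi>. e \<xi> / (of_real \<xi> - k))) \<le> L * b + L * b + L * b * L"
    unfolding eq using Fb[of R] Fb[of a] assms norm_triangle_ineq norm_triangle_ineq4 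
    by (smt (verit))
  also have "\<dots> \<le> 3 * L\<^sup>2 * b"
    using bnn L_nonneg mult_left_mono[OF L_ge_1, of "L * b"] by (simp add: power2_eq_square mult.commute mult.left_commute)
  finally show ?thesis by (simp add: e_def b_def)
qed


text \<open>The frequencies are split at \<open>1 / \<bar>x\<bar>\<close>. With
  \<open>q = cmod k * \<bar>x\<bar>\<close> the logarithmic bound gives at most
  \<open>4 * q powr (-1/4)\<close> below the cut, and the oscillatory bound
  \<open>3 / (1 + q)\<close> gives at most \<open>3 * q powr (-1/4)\<close> above it, each times
  \<open>L\<^sup>2\<close>. Uniformity in R makes this a dominating function later.\<close>

lemma norm_partial_kernel_le:
  assumes "0 \<le> R" "x \<noteq> 0"
  shows "cmod (partial_kernel k R x) \<le> 7 * L\<^sup>2 * (cmod k * \<bar>x\<bar>) powr (-1/4)"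
proof -
  let ?f = "\<lambda>\<xi>. exp (\<i> * of_real x * of_real \<xi>) / (of_real \<xi> - k)"
  define q where "q = cmod k * \<bar>x\<bar>"
  have q: "0 < q" using assms k_nz by (simp add: q_def)
  have LL: "L \<le> L\<^sup>2" using L_ge_1 by (simp add: power2_eq_square)
  have low: "cmod (integral {0..r} ?f) \<le> 4 * L\<^sup>2 * q powr (-1/4)" if "0 \<le> r" "r \<le> 1 / \<bar>x\<bar>" for r
  proof -
    have "r / cmod k \<le> 1 / q"
      using divide_right_mono[OF that(2), of "cmod k"] by (simp add: q_def mult.commute)
    then have "ln (1 + r / cmod k) \<le> ln (1 + 1 / q)"
      using that q by (intro ln_mono) (auto intro!: add_pos_nonneg)
    also have "\<dots> \<le> 4 * (1 / q) powr (1/4)" using q by (intro ln_add_one_le_powr) auto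
    also have "(1 / q) powr (1/4) = q powr (-1/4)" using q by (simp add: powr_divide powr_minus_divide)
    finally have "L * ln (1 + r / cmod k) \<le> L * (4 * q powr (-1/4))"
      by (rule mult_left_mono[OF _ L_nonneg])
    also have "\<dots> \<le> L\<^sup>2 * (4 * q powr (-1/4))" using LL by (intro mult_right_mono) auto
    finally show ?thesis using norm_integral_low_le[OF that(1), of x] by (simp add: mult_ac)
  qed
  show ?thesis
  proof (cases "R \<le> 1 / \<bar>x\<bar>")
    case True
    have "4 * L\<^sup>2 * q powr (-1/4) \<le> 7 * L\<^sup>2 * q powr (-1/4)"
      by (intro mult_right_mono) auto
    with low[OF assms(1) True] show ?thesis
      unfolding partial_kernel_eq_integral q_def by linarith
  next
    case False
    have split: "integral {0..R} ?f = integral {0..1/\<bar>x\<bar>} ?f + integral {1/\<bar>x\<bar>..R} ?f"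
      using False by (intro Henstock_Kurzweil_Integration.integral_combine[symmetric] integrand_integrable_on) auto
    have "cmod (integral {1/\<bar>x\<bar>..R} ?f) \<le> 3 * L\<^sup>2 / (\<bar>x\<bar> * (1 / \<bar>x\<bar> + cmod k))"
      using False assms by (intro norm_integral_tail_le) auto
    also have "\<bar>x\<bar> * (1 / \<bar>x\<bar> + cmod k) = 1 + q"
      using assms by (simp add: q_def field_simps)
    also have "3 * L\<^sup>2 / (1 + q) = 3 * L\<^sup>2 * (1 / (1 + q))" by simp
    also have "\<dots> \<le> 3 * L\<^sup>2 * q powr (-1/4)"
      using q by (intro mult_left_mono inverse_one_add_le_powr) auto
    finally have "cmod (integral {0..R} ?f) \<le> 4 * L\<^sup>2 * q powr (-1/4) + 3 * L\<^sup>2 * q powr (-1/4)"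
      using low[of "1 / \<bar>x\<bar>"] unfolding split
      by (intro norm_triangle_le add_mono) auto
    then show ?thesis unfolding partial_kernel_eq_integral q_def by (simp add: algebra_simps)
  qed
qed

lemma norm_partial_kernel_diff_le:
  assumes "0 \<le> a" "a \<le> R" "x \<noteq> 0"
  shows "cmod (partial_kernel k R x - partial_kernel k a x) \<le> 3 * L\<^sup>2 / \<bar>x\<bar> * inverse (a + cmod k)"
proof -
  let ?f = "\<lambda>\<xi>. exp (\<i> * of_real x * of_real \<xi>) / (of_real \<xi> - k)"
  have "integral {0..R} ?f = integral {0..a} ?f + integral {a..R} ?f"
    using assms by (intro Henstock_Kurzweil_Integration.integral_combine[symmetric] integrand_integrable_on) auto
  then show ?thesis
    using norm_integral_tail_le[OF assms] by (simp add: partial_kernel_eq_integral field_simps)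
qed

text \<open>The tail estimate makes the truncations Cauchy. A limit is first found along the
  integers and then shown to be the limit along all real R.\<close>

lemma partial_kernel_tendsto:
  assumes "x \<noteq> 0"
  shows "((\<lambda>R. partial_kernel k R x) \<longlongrightarrow> 2 * of_real pi * G k x) at_top"
proof -
  let ?P = "\<lambda>R. partial_kernel k R x"
  have small: "((\<lambda>a. 3 * L\<^sup>2 / \<bar>x\<bar> * inverse (a + cmod k)) \<longlongrightarrow> 0) at_top"
  proof (intro tendsto_mult_right_zero tendsto_inverse_0_at_top)
    have "filterlim (\<lambda>a. cmod k + a) at_top at_top"
      by (rule filterlim_tendsto_add_at_top[OF tendsto_const filterlim_ident])
    then show "filterlim (\<lambda>a. a + cmod k) at_top at_top" by (simp add: add.commute)
  qed
  have "Cauchy (\<lambda>n. ?P (real n))"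
  proof (rule CauchyI)
    fix e :: real assume "0 < e"
    with small have "eventually (\<lambda>a. 3 * L\<^sup>2 / \<bar>x\<bar> * inverse (a + cmod k) < e) at_top"
      by (rule order_tendstoD(2))
    then have "eventually (\<lambda>n. 3 * L\<^sup>2 / \<bar>x\<bar> * inverse (real n + cmod k) < e) sequentially"
      by (rule eventually_compose_filterlim[OF _ filterlim_real_sequentially])
    then obtain N where N: "\<And>n. n \<ge> N \<Longrightarrow> 3 * L\<^sup>2 / \<bar>x\<bar> * inverse (real n + cmod k) < e"
      by (auto simp: eventually_sequentially)
    have *: "cmod (?P (real m) - ?P (real n)) < e" if "N \<le> n" "n \<le> m" for m n
      using norm_partial_kernel_diff_le[of "real n" "real m" x] N[OF that(1)] that assms by simp
    show "\<exists>M. \<forall>m\<ge>M. \<forall>n\<ge>M. cmod (?P (real m) - ?P (real n)) < e"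
      using * by (intro exI[of _ N]) (metis nle_le norm_minus_commute)
  qed
  then obtain l where l: "(\<lambda>n. ?P (real n)) \<longlonglongrightarrow> l"
    by (auto simp: Cauchy_convergent_iff convergent_def)
  have close: "cmod (?P a - l) \<le> 3 * L\<^sup>2 / \<bar>x\<bar> * inverse (a + cmod k)" if "0 \<le> a" for a
  proof -
    have "(\<lambda>n. cmod (?P a - ?P (real n))) \<longlonglongrightarrow> cmod (?P a - l)"
      by (intro tendsto_intros l)
    moreover have "eventually (\<lambda>n. cmod (?P a - ?P (real n)) \<le> 3 * L\<^sup>2 / \<bar>x\<bar> * inverse (a + cmod k)) sequentially"
      using eventually_ge_at_top[of "nat \<lceil>a\<rceil>"]
    proof eventually_elim
      case (elim n)
      then have "a \<le> real n" by linarith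
      from norm_partial_kernel_diff_le[OF that this assms] show ?case by (simp add: norm_minus_commute)
    qed
    ultimately show ?thesis by (intro tendsto_upperbound) auto
  qed
  have "eventually (\<lambda>a. cmod (?P a - l) \<le> 3 * L\<^sup>2 / \<bar>x\<bar> * inverse (a + cmod k)) at_top"
    using eventually_ge_at_top[of 0] by eventually_elim (rule close)
  then have "((\<lambda>a. ?P a - l) \<longlongrightarrow> 0) at_top"
    by (rule Lim_null_comparison[OF _ small])
  then have lim: "(?P \<longlongrightarrow> l) at_top" by (rule Lim_null[THEN iffD2])
  \<comment> \<open>\<open>Lim\<close> is meaningful only once convergence is known, so
    \<open>G\<close> can be identified only at this point.\<close>
  then have "G k x = 1 / (2 * of_real pi) * l"
    unfolding G_def partial_kernel_def[symmetric] by (simp add: tendsto_Lim)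
  with lim show ?thesis by simp
qed

lemma norm_G_le:
  assumes "x \<noteq> 0"
  shows "cmod (G k x) \<le> 7 * L\<^sup>2 * (cmod k * \<bar>x\<bar>) powr (-1/4)"
proof -
  have "cmod (2 * of_real pi * G k x) \<le> 7 * L\<^sup>2 * (cmod k * \<bar>x\<bar>) powr (-1/4)"
    using tendsto_norm[OF partial_kernel_tendsto[OF assms]]
  proof (rule tendsto_upperbound)
    show "\<forall>\<^sub>F R in at_top. cmod (partial_kernel k R x) \<le> 7 * L\<^sup>2 * (cmod k * \<bar>x\<bar>) powr (-1/4)"
      using eventually_ge_at_top[of 0] by eventually_elim (rule norm_partial_kernel_le[OF _ assms])
  qed simp
  moreover have "1 * cmod (G k x) \<le> (2 * pi) * cmod (G k x)"
    using pi_gt3 by (intro mult_right_mono) auto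
  ultimately show ?thesis by (simp add: norm_mult)
qed

lemma borel_measurable_partial_kernel [measurable]: "partial_kernel k R \<in> borel_measurable borel"
proof -
  have "partial_kernel k R = (\<lambda>x. LINT \<xi>|lborel. indicator {0..R} \<xi> *\<^sub>R
      (exp (\<i> * of_real x * of_real \<xi>) / (of_real \<xi> - k)))"
    unfolding partial_kernel_def set_lebesgue_integral_def
    by (subst integral_completion) auto
  then show ?thesis by simp
qed

lemma borel_measurable_G [measurable]: "G k \<in> borel_measurable borel"
proof -
  \<comment> \<open>The truncations converge to a multiple of \<open>G\<close> only away from 0. The
    value at 0 is unspecified, so the approximating sequence is made constant there.\<close>
  have "(\<lambda>x. if x = 0 then 2 * of_real pi * G k 0 else 2 * of_real pi * G k x) \<in> borel_measurable borel"
  proof (rule borel_measurable_LIMSEQ_metric)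
    fix x
    show "(\<lambda>n. if x = 0 then 2 * of_real pi * G k 0 else partial_kernel k (real n) x) \<longlonglongrightarrow>
      (if x = 0 then 2 * of_real pi * G k 0 else 2 * of_real pi * G k x)"
      using filterlim_compose[OF partial_kernel_tendsto filterlim_real_sequentially, of x] by auto
  qed measurable
  then have "(\<lambda>x. 1 / (2 * of_real pi) * (if x = 0 then 2 * of_real pi * G k 0 else 2 * of_real pi * G k x))
     \<in> borel_measurable borel" by measurable
  moreover have "(\<lambda>x. 1 / (2 * of_real pi) * (if x = 0 then 2 * of_real pi * G k 0 else 2 * of_real pi * G k x)) = G k"
    by auto
  ultimately show ?thesis by simp
qed

end

section \<open>Weighted spaces and the integral operator\<close>

lemma weight_ge_1: "1 \<le> weight x"
  by (simp add: weight_def)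

lemma one_le_weight_powr: "0 \<le> d \<Longrightarrow> 1 \<le> weight x powr d"
  by (simp add: ge_one_powr_ge_zero weight_ge_1)

lemma borel_measurable_weight [measurable]: "weight \<in> borel_measurable borel"
  unfolding weight_def[abs_def] by measurable

lemma borel_measurable_lebesgueI: "f \<in> borel_measurable borel \<Longrightarrow> f \<in> borel_measurable lebesgue"
  by (rule measurable_completion) simp

text \<open>For nonnegative functions gauge integrability is absolute, so the known improper
  integrals of powers become Lebesgue integrals.\<close>

lemma integrable_lborelI_HK:
  fixes f :: "real \<Rightarrow> real"
  assumes "f integrable_on S" "\<And>x. x \<in> S \<Longrightarrow> 0 \<le> f x"
    and [measurable]: "f \<in> borel_measurable borel" "S \<in> sets borel"
  shows "integrable lborel (\<lambda>x. indicator S x * f x)"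
proof -
  have "f absolutely_integrable_on S"
    using assms by (intro nonnegative_absolutely_integrable_1) auto
  then show ?thesis
    by (simp add: set_integrable_def integrable_completion)
qed

lemma integrable_weight_powr:
  assumes "1 < p"
  shows "integrable lborel (\<lambda>x. weight x powr (-p))"
proof -
  define f where "f = (\<lambda>x::real. indicator {1..} x * x powr (-p))"
  have [measurable]: "f \<in> borel_measurable borel" by (simp add: f_def)
  have f: "integrable lborel f"
    unfolding f_def using assms has_integral_powr_to_inf[of "-p" 1]
    by (intro integrable_lborelI_HK) (auto simp: integrable_on_def)
  \<comment> \<open>The terms \<open>f (1 + x)\<close> and \<open>f (1 - x)\<close> are nonnegative,
    and one of them equals \<open>weight x powr (-p)\<close>, according to the sign of x.\<close>
  have "integrable lborel (\<lambda>x. f (1 + 1 * x) + f (1 + (-1) * x))"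
    using f by (intro Bochner_Integration.integrable_add lborel_integrable_real_affine) auto
  then show ?thesis
  proof (rule Bochner_Integration.integrable_bound)
    show "AE x in lborel. norm (weight x powr (-p)) \<le> norm (f (1 + 1 * x) + f (1 + (-1) * x))"
      by (rule AE_I2) (auto simp: f_def weight_def indicator_def abs_real_def)
  qed auto
qed

lemma integrable_inverse_sqrt_near_0:
  "integrable lborel (\<lambda>z::real. indicator {-1..1} z * \<bar>z\<bar> powr (-1/2))"
proof -
  define f where "f = (\<lambda>x::real. indicator {0..1} x * x powr (-1/2))"
  have [measurable]: "f \<in> borel_measurable borel" by (simp add: f_def)
  have f: "integrable lborel f"
    unfolding f_def by (intro integrable_lborelI_HK integrable_on_powr_from_0) auto
  have "integrable lborel (\<lambda>x. f (0 + 1 * x) + f (0 + (-1) * x))"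
    using f by (intro Bochner_Integration.integrable_add lborel_integrable_real_affine) auto
  then show ?thesis
  proof (rule Bochner_Integration.integrable_bound)
    show "AE x in lborel. norm (indicator {-1..1} x * \<bar>x\<bar> powr (-1/2) :: real) \<le> norm (f (0 + 1 * x) + f (0 + (-1) * x))"
      by (rule AE_I2) (auto simp: f_def indicator_def abs_real_def)
  qed auto
qed

lemma L2_weighted_integrable_square:
  assumes f: "f \<in> L2_weighted s" and d: "d \<le> s"
  shows "integrable lebesgue (\<lambda>x. (weight x powr d * cmod (f x))\<^sup>2)"
proof -
  have [measurable]: "f \<in> borel_measurable lebesgue" and
    i: "integrable lebesgue (\<lambda>x. (weight x powr s * cmod (f x))\<^sup>2)"
    using f by (auto simp: L2_weighted_def)
  have [measurable]: "weight \<in> borel_measurable lebesgue" by (simp add: borel_measurable_lebesgueI)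
  show ?thesis
    using i
  proof (rule Bochner_Integration.integrable_bound)
    have "(weight x powr d * cmod (f x))\<^sup>2 \<le> (weight x powr s * cmod (f x))\<^sup>2" for x
      using d weight_ge_1[of x] by (intro power_mono mult_right_mono powr_mono) auto
    then show "AE x in lebesgue. norm ((weight x powr d * cmod (f x))\<^sup>2)
        \<le> norm ((weight x powr s * cmod (f x))\<^sup>2)" by simp
  qed simp
qed

text \<open>A pointwise form of Cauchy-Schwarz: \<open>a * b \<le> a\<^sup>2 + b\<^sup>2\<close>
  with a the weighted function and \<open>b = weight x powr (d - s)\<close>. The square of b is
  integrable because \<open>2 * (s - d) > 1\<close>.\<close>

lemma L2_weighted_integrable:
  assumes f: "f \<in> L2_weighted s" and d: "d < s - 1/2"
  shows "integrable lebesgue (\<lambda>x. weight x powr d * cmod (f x))"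
proof -
  have [measurable]: "f \<in> borel_measurable lebesgue" and
    i: "integrable lebesgue (\<lambda>x. (weight x powr s * cmod (f x))\<^sup>2)"
    using f by (auto simp: L2_weighted_def)
  have [measurable]: "weight \<in> borel_measurable lebesgue" by (simp add: borel_measurable_lebesgueI)
  have "integrable lebesgue (\<lambda>x. weight x powr (- (2 * (s - d))))"
    using integrable_weight_powr[of "2 * (s - d)"] d by (simp add: integrable_completion)
  with i have "integrable lebesgue
      (\<lambda>x. (weight x powr s * cmod (f x))\<^sup>2 + weight x powr (- (2 * (s - d))))" by simp
  then show ?thesis
  proof (rule Bochner_Integration.integrable_bound)
    have "weight x powr d * cmod (f x) \<le> (weight x powr s * cmod (f x))\<^sup>2 + weight x powr (- (2 * (s - d)))" for x
    proof -
      define a b where "a = weight x powr s * cmod (f x)" and "b = weight x powr (d - s)"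
      have "a * b = weight x powr d * cmod (f x)"
        by (simp add: a_def b_def flip: powr_add)
      moreover have "b\<^sup>2 = weight x powr (- (2 * (s - d)))"
        by (simp add: b_def power2_eq_square algebra_simps flip: powr_add)
      moreover have "a * b \<le> a\<^sup>2 + b\<^sup>2"
        using sum_squares_bound[of a b] zero_le_power2[of a] zero_le_power2[of b] by linarith
      ultimately show ?thesis unfolding a_def by (simp only:)
    qed
    then show "AE x in lebesgue. norm (weight x powr d * cmod (f x))
        \<le> norm ((weight x powr s * cmod (f x))\<^sup>2 + weight x powr (- (2 * (s - d))))" by simp
  qed simp
qed

text \<open>What the argument extracts from membership in \<open>Hss s\<close>, for a Borel
  representative v and \<delta> = s - s1: the two weighted L1 bounds come from \<delta> < s - 1/2,
  the square bound from \<delta> \<le> s.\<close>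

locale potential =
  fixes v :: "real \<Rightarrow> complex" and \<delta> :: real
  assumes v_meas [measurable]: "v \<in> borel_measurable borel"
    and \<delta>_nonneg: "0 \<le> \<delta>"
    and wv_integrable: "integrable lborel (\<lambda>y. weight y powr \<delta> * cmod (v y))"
    and wv_sq_integrable: "integrable lborel (\<lambda>y. (weight y powr \<delta> * cmod (v y))\<^sup>2)"
    and w_fourier_integrable: "integrable lborel (\<lambda>\<xi>. weight \<xi> powr \<delta> * cmod (fourier v \<xi>))"
begin

text \<open>A bound, uniform in x, for the weighted singular integral in
  \<open>singular_kernel\<close>; its summands are the integrals of the terms of the pointwise
  majorant there.\<close>

definition S :: real where
  "S = (LINT z|lborel. indicator {-1..1} z * \<bar>z\<bar> powr (-1/2))
     + (LINT y|lborel. (weight y powr \<delta> * cmod (v y))\<^sup>2)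
     + (LINT y|lborel. weight y powr \<delta> * cmod (v y))"

lemma S_nonneg: "0 \<le> S"
  unfolding S_def by (intro add_nonneg_nonneg Bochner_Integration.integral_nonneg) auto

lemma v_integrable: "integrable lborel v"
  using wv_integrable
proof (rule Bochner_Integration.integrable_bound)
  show "AE y in lborel. norm (v y) \<le> norm (weight y powr \<delta> * cmod (v y))"
    using mult_right_mono[OF one_le_weight_powr[OF \<delta>_nonneg], of "cmod (v y)" y for y] by simp
qed simp

text \<open>
  With \<open>g = weight powr \<delta> * cmod v\<close>, AM-GM gives \<open>\<bar>z\<bar> powr (-1/4) * g \<le> \<bar>z\<bar> powr (-1/2) + g\<^sup>2\<close>
  for \<open>\<bar>z\<bar> \<le> 1\<close>, and trivially \<open>\<bar>z\<bar> powr (-1/4) * g \<le> g\<close> for \<open>\<bar>z\<bar> > 1\<close>.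
\<close>

lemma singular_kernel:
  fixes x :: real
  defines "f \<equiv> (\<lambda>y. \<bar>x - y\<bar> powr (-1/4) * (weight y powr \<delta> * cmod (v y)))"
  shows "integrable lborel f" "(LINT y|lborel. f y) \<le> S"
proof -
  define i where "i = (\<lambda>z::real. indicator {-1..1} z * \<bar>z\<bar> powr (-1/2) :: real)"
  define g where "g = (\<lambda>y. weight y powr \<delta> * cmod (v y))"
  define F where "F = (\<lambda>y. i (x + (-1) * y) + (g y)\<^sup>2 + g y)"
  have ii: "integrable lborel i" unfolding i_def by (rule integrable_inverse_sqrt_near_0)
  have gi: "integrable lborel g" "integrable lborel (\<lambda>y. (g y)\<^sup>2)"
    using wv_integrable wv_sq_integrable by (auto simp: g_def)
  have ii': "integrable lborel (\<lambda>y. i (x + (-1) * y))"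
    using lborel_integrable_real_affine[OF ii, of "-1" x] by simp
  have F: "integrable lborel F" unfolding F_def using ii' gi by simp
  have le: "f y \<le> F y" for y
  proof (cases "\<bar>x - y\<bar> \<le> 1")
    case True
    define a where "a = \<bar>x - y\<bar> powr (-1/4)"
    have "a * a = i (x + (-1) * y)"
      using True by (simp add: a_def i_def indicator_def abs_le_iff flip: powr_add)
    moreover have "a * g y \<le> a\<^sup>2 + (g y)\<^sup>2"
      using sum_squares_bound[of a "g y"] zero_le_power2[of a] zero_le_power2[of "g y"] by linarith
    moreover have "0 \<le> g y" by (simp add: g_def)
    moreover have "f y = a * g y" by (simp add: f_def g_def a_def)
    ultimately show ?thesis unfolding F_def power2_eq_square by linarith
  next
    case False
    have "\<bar>x - y\<bar> powr (-1/4) \<le> \<bar>x - y\<bar> powr 0" using False by (intro powr_mono) auto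
    then have "\<bar>x - y\<bar> powr (-1/4) * g y \<le> 1 * g y"
      using False by (intro mult_right_mono) (auto simp: g_def split: if_splits)
    moreover have "0 \<le> i (x + (-1) * y)" by (simp add: i_def)
    moreover have "0 \<le> (g y)\<^sup>2" by simp
    moreover have "f y = \<bar>x - y\<bar> powr (-1/4) * g y" by (simp add: f_def g_def)
    ultimately show ?thesis unfolding F_def by linarith
  qed
  have f0: "0 \<le> f y" for y by (simp add: f_def)
  have [measurable]: "f \<in> borel_measurable borel" unfolding f_def by measurable
  show fi: "integrable lborel f"
    using F by (rule Bochner_Integration.integrable_bound) (use le f0 in \<open>auto simp: abs_of_nonneg intro: order_trans[OF _ abs_ge_self]\<close>)
  have "(LINT y|lborel. f y) \<le> (LINT y|lborel. F y)" using fi F le by (intro integral_mono)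
  also have "(LINT y|lborel. F y) = (LINT y|lborel. i (x + (-1) * y)) + (LINT y|lborel. (g y)\<^sup>2) + (LINT y|lborel. g y)"
    unfolding F_def using ii' gi by simp
  \<comment> \<open>Reflection and translation preserve Lebesgue measure, which removes the
    dependence on x.\<close>
  also have "(LINT y|lborel. i (x + (-1) * y)) = (LINT y|lborel. i y)"
    using lborel_integral_real_affine[of "-1" i x] by simp
  finally show "(LINT y|lborel. f y) \<le> S" by (simp add: S_def i_def g_def)
qed

end

section \<open>The integral operator and its norm\<close>

locale jost_operator = resolvent_bound + potential
begin

text \<open>Bounds the norm of \<open>T\<close> from functions of growth
  \<open>weight powr \<delta>\<close> into bounded functions; its decay in \<open>cmod k\<close>
  yields the contraction.\<close>

definition q :: real where
  "q = 7 * L\<^sup>2 * S * cmod k powr (-1/4)"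

definition T :: "(real \<Rightarrow> complex) \<Rightarrow> real \<Rightarrow> complex" where
  "T h = convolution (G k) (\<lambda>y. v y * h y)"

context
  fixes h :: "real \<Rightarrow> complex" and A :: real
  assumes h [measurable]: "h \<in> borel_measurable lebesgue"
    and h_le: "AE y in lebesgue. cmod (h y) \<le> A * weight y powr \<delta>"
begin

lemma T_dominated:
  "AE y in lebesgue. cmod (G k (x - y) * (v y * h y))
     \<le> 7 * L\<^sup>2 * cmod k powr (-1/4) * A * (\<bar>x - y\<bar> powr (-1/4) * (weight y powr \<delta> * cmod (v y)))"
proof -
  \<comment> \<open>The kernel bound fails on the diagonal, which is a null set in y.\<close>
  have "AE y in lebesgue. y \<noteq> x"
    using AE_lborel_singleton[of x] by (rule AE_completion)
  with h_le show ?thesis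
  proof eventually_elim
    case (elim y)
    have "cmod (G k (x - y)) * (cmod (v y) * cmod (h y))
       \<le> (7 * L\<^sup>2 * (cmod k * \<bar>x - y\<bar>) powr (-1/4)) * (cmod (v y) * (A * weight y powr \<delta>))"
      using elim norm_G_le[of "x - y"] by (intro mult_mono mult_left_mono) auto
    then show ?case by (simp add: norm_mult powr_mult mult_ac)
  qed
qed

lemma T_integrable: "integrable lebesgue (\<lambda>y. G k (x - y) * (v y * h y))"
proof (rule Bochner_Integration.integrable_bound)
  show "integrable lebesgue (\<lambda>y. 7 * L\<^sup>2 * cmod k powr (-1/4) * A *
      (\<bar>x - y\<bar> powr (-1/4) * (weight y powr \<delta> * cmod (v y))))"
    using singular_kernel(1)[of x] by (simp add: integrable_completion)
  have [measurable]: "(\<lambda>y. G k (x - y)) \<in> borel_measurable lebesgue" "v \<in> borel_measurable lebesgue"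
    by (auto intro!: borel_measurable_lebesgueI)
  show "(\<lambda>y. G k (x - y) * (v y * h y)) \<in> borel_measurable lebesgue" by measurable
  show "AE y in lebesgue. norm (G k (x - y) * (v y * h y)) \<le> norm (7 * L\<^sup>2 * cmod k powr (-1/4) * A *
      (\<bar>x - y\<bar> powr (-1/4) * (weight y powr \<delta> * cmod (v y))))"
    using T_dominated[of x] by eventually_elim (rule order_trans, assumption, simp)
qed

lemma norm_T_le:
  assumes A: "0 \<le> A"
  shows "cmod (T h x) \<le> q * A"
proof -
  let ?f = "\<lambda>y. \<bar>x - y\<bar> powr (-1/4) * (weight y powr \<delta> * cmod (v y))"
  let ?c = "7 * L\<^sup>2 * cmod k powr (-1/4) * A"
  have i: "integrable lebesgue ?f" and e: "(LINT y|lebesgue. ?f y) = (LINT y|lborel. ?f y)"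
    using singular_kernel(1)[of x] by (auto simp: integrable_completion integral_completion)
  have "cmod (T h x) \<le> (LINT y|lebesgue. cmod (G k (x - y) * (v y * h y)))"
    unfolding T_def convolution_def by (rule integral_norm_bound)
  also have "\<dots> \<le> (LINT y|lebesgue. ?c * ?f y)"
    using T_dominated[of x] T_integrable[of x] i
    by (intro integral_mono_AE integrable_norm integrable_mult_right) auto
  also have "\<dots> = ?c * (LINT y|lborel. ?f y)" using e by simp
  also have "\<dots> \<le> ?c * S" using singular_kernel(2)[of x] A by (intro mult_left_mono) auto
  finally show ?thesis by (simp add: q_def mult_ac)
qed

end

lemma bounded_imp_weighted:
  assumes "\<And>y. cmod (h y) \<le> A"
  shows "AE y in lebesgue. cmod (h y) \<le> A * weight y powr \<delta>"
proof (rule AE_I2)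
  fix y
  have "0 \<le> A" using assms[of y] norm_ge_zero order_trans by blast
  then have "A * 1 \<le> A * weight y powr \<delta>" by (intro mult_left_mono one_le_weight_powr \<delta>_nonneg)
  then show "cmod (h y) \<le> A * weight y powr \<delta>" using assms[of y] by simp
qed

text \<open>Linearity of the integral requires integrable integrands; the growth hypotheses on both
  functions provide this.\<close>

lemma T_diff:
  assumes "h \<in> borel_measurable lebesgue" "AE y in lebesgue. cmod (h y) \<le> A * weight y powr \<delta>"
    and "g \<in> borel_measurable lebesgue" "AE y in lebesgue. cmod (g y) \<le> B * weight y powr \<delta>"
  shows "T h x - T g x = T (\<lambda>y. h y - g y) x"
  unfolding T_def convolution_def
  using T_integrable[OF assms(1,2), of x] T_integrable[OF assms(3,4), of x]
  by (simp add: right_diff_distrib flip: Bochner_Integration.integral_diff)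

lemma T_measurable [measurable]:
  assumes [measurable]: "h \<in> borel_measurable borel"
  shows "T h \<in> borel_measurable borel"
proof -
  have "T h = (\<lambda>x. LINT y|lborel. G k (x - y) * (v y * h y))"
    unfolding T_def convolution_def by (subst integral_completion) auto
  then show ?thesis by simp
qed

end

section \<open>The first-order term\<close>

lemma fourier_eq_lborel:
  assumes [measurable]: "f \<in> borel_measurable borel"
  shows "fourier f \<xi> = (LINT x|lborel. exp (- (\<i> * of_real \<xi> * of_real x)) * f x)"
  unfolding fourier_def by (subst integral_completion) auto

lemma borel_measurable_fourier [measurable]:
  assumes [measurable]: "f \<in> borel_measurable borel"
  shows "fourier f \<in> borel_measurable borel"
proof -
  have "fourier f = (\<lambda>\<xi>. LINT x|lborel. exp (- (\<i> * of_real \<xi> * of_real x)) * f x)"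
    by (rule ext) (rule fourier_eq_lborel[OF assms])
  then show ?thesis by simp
qed

context potential
begin

definition H :: real where
  "H = (LINT \<xi>|lborel. weight \<xi> powr \<delta> * cmod (fourier v \<xi>))"

lemma H_nonneg: "0 \<le> H"
  unfolding H_def by (intro Bochner_Integration.integral_nonneg) auto

text \<open>In the applications g contains the exponential as well as the multiplier, so the bound
  is uniform in x. The factor 1/(2 pi) is estimated by 1.\<close>

lemma norm_fourier_integral_le:
  assumes [measurable]: "g \<in> borel_measurable borel"
    and le: "\<And>\<xi>. cmod (g \<xi>) \<le> c * weight \<xi> powr \<delta>"
  shows "integrable lborel (\<lambda>\<xi>. g \<xi> * fourier v \<xi>)"
    and "cmod (1 / (2 * of_real pi) * (LINT \<xi>|lborel. g \<xi> * fourier v \<xi>)) \<le> c * H"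
proof -
  have c: "0 \<le> c"
    using order_trans[OF norm_ge_zero le[of 0]] by (simp add: weight_def)
  have le': "cmod (g \<xi> * fourier v \<xi>) \<le> c * (weight \<xi> powr \<delta> * cmod (fourier v \<xi>))" for \<xi>
    using mult_right_mono[OF le, of "cmod (fourier v \<xi>)"] by (simp add: norm_mult mult_ac)
  have i: "integrable lborel (\<lambda>\<xi>. c * (weight \<xi> powr \<delta> * cmod (fourier v \<xi>)))"
    using w_fourier_integrable by simp
  show int: "integrable lborel (\<lambda>\<xi>. g \<xi> * fourier v \<xi>)"
    using i by (rule Bochner_Integration.integrable_bound) (auto intro!: AE_I2 order_trans[OF le' abs_ge_self])
  have "cmod (LINT \<xi>|lborel. g \<xi> * fourier v \<xi>) \<le> (LINT \<xi>|lborel. cmod (g \<xi> * fourier v \<xi>))"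
    by (rule integral_norm_bound)
  also have "\<dots> \<le> (LINT \<xi>|lborel. c * (weight \<xi> powr \<delta> * cmod (fourier v \<xi>)))"
    using int i le' by (intro integral_mono integrable_norm) auto
  also have "\<dots> = c * H" by (simp add: H_def)
  finally have *: "cmod (LINT \<xi>|lborel. g \<xi> * fourier v \<xi>) \<le> c * H" .
  have "cmod (1 / (2 * of_real pi) * (LINT \<xi>|lborel. g \<xi> * fourier v \<xi>))
      = 1 / (2 * pi) * cmod (LINT \<xi>|lborel. g \<xi> * fourier v \<xi>)"
    by (simp add: norm_mult norm_divide)
  also have "\<dots> \<le> 1 * cmod (LINT \<xi>|lborel. g \<xi> * fourier v \<xi>)"
    using pi_gt3 by (intro mult_right_mono) auto
  finally show "cmod (1 / (2 * of_real pi) * (LINT \<xi>|lborel. g \<xi> * fourier v \<xi>)) \<le> c * H"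
    using * by simp
qed

end

context jost_operator
begin

text \<open>On the compact frequency range the double integral converges absolutely, so Fubini
  applies; factoring the exponential of x - y turns the inner integral into
  \<open>fourier v\<close>.\<close>

lemma partial_kernel_convolution:
  "(LINT y|lborel. partial_kernel k R (x - y) * v y) =
   (LINT \<xi>|lborel. indicator {0..R} \<xi> * (exp (\<i> * of_real x * of_real \<xi>) / (of_real \<xi> - k)) * fourier v \<xi>)"
proof -
  define F where "F = (\<lambda>\<xi> y. indicator {0..R} \<xi> * (exp (\<i> * of_real (x - y) * of_real \<xi>) / (of_real \<xi> - k)) * v y)"
  have [measurable]: "case_prod F \<in> borel_measurable (lborel \<Otimes>\<^sub>M lborel)"
    unfolding F_def by measurable
  have nF: "cmod (F \<xi> y) = indicator {0..R} \<xi> * (1 / cmod (of_real \<xi> - k)) * cmod (v y)" for \<xi> y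
    by (simp add: F_def norm_mult norm_divide mult.assoc norm_exp_i_times indicator_def flip: of_real_mult)
  have c: "integrable lborel (\<lambda>\<xi>. indicator {0..R} \<xi> * (1 / cmod (of_real \<xi> - k)))"
  proof -
    have "continuous_on {0..R} (\<lambda>\<xi>. 1 / cmod (of_real \<xi> - k))"
      using diff_nz by (intro continuous_intros) auto
    from borel_integrable_atLeastAtMost'[OF this] show ?thesis
      by (simp add: set_integrable_def)
  qed
  have Fy: "integrable lborel (\<lambda>y. F \<xi> y)" for \<xi>
  proof -
    have "integrable lborel (\<lambda>y. indicator {0..R} \<xi> * (1 / cmod (of_real \<xi> - k)) * cmod (v y))"
      using v_integrable by (intro integrable_mult_right integrable_norm)
    then show ?thesis
    proof (rule Bochner_Integration.integrable_bound)
      show "F \<xi> \<in> borel_measurable lborel" unfolding F_def by measurable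
    qed (simp add: nF del: of_real_diff)
  qed
  have "integrable (lborel \<Otimes>\<^sub>M lborel) (case_prod F)"
  proof (rule lborel_pair.Fubini_integrable)
    have "integrable lborel (\<lambda>\<xi>. indicator {0..R} \<xi> * (1 / cmod (of_real \<xi> - k)) * (LINT y|lborel. cmod (v y)))"
      using c by (rule integrable_mult_left)
    then show "integrable lborel (\<lambda>\<xi>. LINT y|lborel. norm (case_prod F (\<xi>, y)))"
      by (simp only: prod.case nF integral_mult_right_zero)
  qed (use Fy in auto)
  from lborel_pair.Fubini_integral[OF this]
  have "(LINT y|lborel. LINT \<xi>|lborel. F \<xi> y) = (LINT \<xi>|lborel. LINT y|lborel. F \<xi> y)" .
  moreover have "(LINT \<xi>|lborel. F \<xi> y) = partial_kernel k R (x - y) * v y" for y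
  proof -
    have "partial_kernel k R (x - y) = (LINT \<xi>|lborel. indicator {0..R} \<xi> *\<^sub>R
      (exp (\<i> * of_real (x - y) * of_real \<xi>) / (of_real \<xi> - k)))"
      unfolding partial_kernel_def set_lebesgue_integral_def
      by (subst integral_completion) auto
    also have "\<dots> = (LINT \<xi>|lborel. indicator {0..R} \<xi> *
      (exp (\<i> * of_real (x - y) * of_real \<xi>) / (of_real \<xi> - k)))"
      by (intro Bochner_Integration.integral_cong) (auto simp: indicator_def)
    finally show ?thesis unfolding F_def by (simp only: integral_mult_left_zero)
  qed
  moreover have "(LINT y|lborel. F \<xi> y) =
     indicator {0..R} \<xi> * (exp (\<i> * of_real x * of_real \<xi>) / (of_real \<xi> - k)) * fourier v \<xi>" for \<xi>
  proof -
    have "F \<xi> y = indicator {0..R} \<xi> * (exp (\<i> * of_real x * of_real \<xi>) / (of_real \<xi> - k)) *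
        (exp (- (\<i> * of_real \<xi> * of_real y)) * v y)" for y
    proof -
      have "exp (\<i> * of_real (x - y) * of_real \<xi>) =
          exp (\<i> * of_real x * of_real \<xi>) * exp (- (\<i> * of_real \<xi> * of_real y))"
        by (simp add: algebra_simps flip: exp_add)
      then show ?thesis by (simp add: F_def)
    qed
    then show ?thesis by (simp only: integral_mult_right_zero fourier_eq_lborel[OF v_meas])
  qed
  ultimately show ?thesis by simp
qed

lemma norm_fourier_multiplier_le:
  "cmod (indicator {0<..} \<xi> * (exp (\<i> * of_real x * of_real \<xi>) / (of_real \<xi> - k)))
    \<le> L / cmod k * weight \<xi> powr \<delta>"
proof (cases "0 < \<xi>")
  case True
  have "cmod (indicator {0<..} \<xi> * (exp (\<i> * of_real x * of_real \<xi>) / (of_real \<xi> - k))) =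
      1 / cmod (of_real \<xi> - k)"
    using True by (simp add: norm_divide mult.assoc norm_exp_i_times flip: of_real_mult)
  also have "\<dots> \<le> L / (\<xi> + cmod k)" using True by (intro norm_inverse_le) auto
  also have "\<dots> \<le> L / cmod k"
    using True k_nz L_nonneg by (intro divide_left_mono) (auto intro!: mult_pos_pos add_pos_nonneg)
  also have "\<dots> \<le> L / cmod k * weight \<xi> powr \<delta>"
    using mult_left_mono[OF one_le_weight_powr[OF \<delta>_nonneg], of "L / cmod k" \<xi>] L_nonneg by simp
  finally show ?thesis .
qed (use L_nonneg in simp)

text \<open>R tends to infinity on both sides of the truncated identity. The singular kernel
  dominates in physical space, the integrable Fourier transform in frequency space, and the two
  limits must agree.\<close>

lemma T_one_eq:
  "T (\<lambda>_. 1) x = 1 / (2 * of_real pi) * (LINT \<xi>|lborel.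
     indicator {0<..} \<xi> * (exp (\<i> * of_real x * of_real \<xi>) / (of_real \<xi> - k)) * fourier v \<xi>)"
proof -
  let ?e = "\<lambda>\<xi>. exp (\<i> * of_real x * of_real \<xi>) / (of_real \<xi> - k)"
  have "(\<lambda>n. LINT y|lborel. partial_kernel k (real n) (x - y) * v y)
     \<longlonglongrightarrow> (LINT y|lborel. 2 * of_real pi * G k (x - y) * v y)"
  proof (rule integral_dominated_convergence)
    show "integrable lborel (\<lambda>y. 7 * L\<^sup>2 * cmod k powr (-1/4) *
        (\<bar>x - y\<bar> powr (-1/4) * (weight y powr \<delta> * cmod (v y))))"
      using singular_kernel(1)[of x] by simp
    show "AE y in lborel. (\<lambda>n. partial_kernel k (real n) (x - y) * v y)
        \<longlonglongrightarrow> 2 * of_real pi * G k (x - y) * v y"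
      using AE_lborel_singleton[of x]
      by eventually_elim
        (intro tendsto_mult tendsto_const filterlim_compose[OF partial_kernel_tendsto filterlim_real_sequentially], auto)
    show "AE y in lborel. norm (partial_kernel k (real n) (x - y) * v y)
        \<le> 7 * L\<^sup>2 * cmod k powr (-1/4) * (\<bar>x - y\<bar> powr (-1/4) * (weight y powr \<delta> * cmod (v y)))" for n
      using AE_lborel_singleton[of x]
    proof eventually_elim
      case (elim y)
      have "cmod (v y) \<le> weight y powr \<delta> * cmod (v y)"
        using mult_right_mono[OF one_le_weight_powr[OF \<delta>_nonneg], of "cmod (v y)" y] by simp
      then have "cmod (partial_kernel k (real n) (x - y)) * cmod (v y) \<le>
          (7 * L\<^sup>2 * (cmod k * \<bar>x - y\<bar>) powr (-1/4)) * (weight y powr \<delta> * cmod (v y))"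
        using elim by (intro mult_mono norm_partial_kernel_le) auto
      then show ?case by (simp add: norm_mult powr_mult mult_ac)
    qed
  qed measurable
  moreover have "(\<lambda>n. LINT y|lborel. partial_kernel k (real n) (x - y) * v y)
     \<longlonglongrightarrow> (LINT \<xi>|lborel. indicator {0<..} \<xi> * ?e \<xi> * fourier v \<xi>)"
    unfolding partial_kernel_convolution
  proof (rule integral_dominated_convergence)
    show "integrable lborel (\<lambda>\<xi>. norm (indicator {0<..} \<xi> * ?e \<xi> * fourier v \<xi>))"
      by (intro integrable_norm norm_fourier_integral_le(1)[OF _ norm_fourier_multiplier_le]) auto
    show "AE \<xi> in lborel. (\<lambda>n. indicator {0..real n} \<xi> * ?e \<xi> * fourier v \<xi>)
        \<longlonglongrightarrow> indicator {0<..} \<xi> * ?e \<xi> * fourier v \<xi>"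
      using AE_lborel_singleton[of 0]
    proof eventually_elim
      case (elim \<xi>)
      \<comment> \<open>Once n exceeds \<xi> the two indicators agree, the point 0 having been
        discarded, so the sequence is eventually constant.\<close>
      have "eventually (\<lambda>n. indicator {0..real n} \<xi> * ?e \<xi> * fourier v \<xi>
          = indicator {0<..} \<xi> * ?e \<xi> * fourier v \<xi>) sequentially"
        using eventually_ge_at_top[of "nat \<lceil>\<xi>\<rceil>"]
      proof eventually_elim
        case (elim n)
        then have "\<xi> \<le> real n" by linarith
        then show ?case using \<open>\<xi> \<noteq> 0\<close> by (simp add: indicator_def)
      qed
      then show ?case by (rule tendsto_eventually)
    qed
    show "AE \<xi> in lborel. norm (indicator {0..real n} \<xi> * ?e \<xi> * fourier v \<xi>)
        \<le> norm (indicator {0<..} \<xi> * ?e \<xi> * fourier v \<xi>)" for n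
      using AE_lborel_singleton[of 0] by eventually_elim (simp add: indicator_def)
  qed measurable
  ultimately have "(LINT y|lborel. 2 * of_real pi * G k (x - y) * v y)
     = (LINT \<xi>|lborel. indicator {0<..} \<xi> * ?e \<xi> * fourier v \<xi>)"
    by (rule LIMSEQ_unique)
  moreover have "(LINT y|lborel. 2 * of_real pi * G k (x - y) * v y) = 2 * of_real pi * T (\<lambda>_. 1) x"
    unfolding T_def convolution_def by (subst integral_completion) (auto simp: mult.assoc)
  ultimately have "2 * of_real pi * T (\<lambda>_. 1) x
     = (LINT \<xi>|lborel. indicator {0<..} \<xi> * ?e \<xi> * fourier v \<xi>)"
    by (simp only:)
  moreover have "T (\<lambda>_. 1) x = 1 / (2 * of_real pi) * (2 * of_real pi * T (\<lambda>_. 1) x)" by simp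
  ultimately show ?thesis by (simp only:)
qed

lemma norm_T_one_le: "cmod (T (\<lambda>_. 1) x) \<le> L / cmod k * H"
  unfolding T_one_eq by (rule norm_fourier_integral_le(2)[OF _ norm_fourier_multiplier_le]) measurable

lemma norm_T_one_add_cauchy_plus_le:
  assumes "0 \<le> \<epsilon>" "\<epsilon> \<le> 1" "\<epsilon> \<le> \<delta>"
  shows "cmod (T (\<lambda>_. 1) x + cauchy_plus v x / k) \<le> L / cmod k powr (1 + \<epsilon>) * H"
proof -
  let ?E = "\<lambda>\<xi>. exp (\<i> * of_real x * of_real \<xi>)"
  let ?I = "\<lambda>\<xi>. indicator {0<..} \<xi> :: complex"
  define g where "g = (\<lambda>\<xi>. ?I \<xi> * (?E \<xi> * of_real \<xi> / (k * (of_real \<xi> - k))))"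
  have Kpos: "0 < cmod k" using k_nz by simp
  have I_le: "cmod (?I \<xi> * ?E \<xi> / k) \<le> 1 / cmod k * weight \<xi> powr \<delta>" for \<xi>
    using one_le_weight_powr[OF \<delta>_nonneg, of \<xi>] Kpos
    by (auto simp: indicator_def norm_divide mult.assoc norm_exp_i_times divide_right_mono simp flip: of_real_mult)
  have "cauchy_plus v x / k = 1 / (2 * of_real pi) * (LINT \<xi>|lborel. ?I \<xi> * ?E \<xi> / k * fourier v \<xi>)"
  proof -
    have "cauchy_plus v x = 1 / (2 * of_real pi) * (LINT \<xi>|lborel. ?I \<xi> * ?E \<xi> * fourier v \<xi>)"
      unfolding cauchy_plus_def inverse_fourier_def by (subst integral_completion) (auto simp: mult_ac)
    then show ?thesis by (simp add: mult.commute flip: integral_divide_zero)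
  qed
  then have "T (\<lambda>_. 1) x + cauchy_plus v x / k = 1 / (2 * of_real pi) *
     ((LINT \<xi>|lborel. ?I \<xi> * (?E \<xi> / (of_real \<xi> - k)) * fourier v \<xi>)
       + (LINT \<xi>|lborel. ?I \<xi> * ?E \<xi> / k * fourier v \<xi>))"
    by (simp only: T_one_eq distrib_left)
  also have "(LINT \<xi>|lborel. ?I \<xi> * (?E \<xi> / (of_real \<xi> - k)) * fourier v \<xi>)
       + (LINT \<xi>|lborel. ?I \<xi> * ?E \<xi> / k * fourier v \<xi>)
       = (LINT \<xi>|lborel. ?I \<xi> * (?E \<xi> / (of_real \<xi> - k)) * fourier v \<xi> + ?I \<xi> * ?E \<xi> / k * fourier v \<xi>)"
    by (rule Bochner_Integration.integral_add[symmetric])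
      (intro norm_fourier_integral_le(1)[OF _ norm_fourier_multiplier_le]
        norm_fourier_integral_le(1)[OF _ I_le]; measurable)+
  also have "\<dots> = (LINT \<xi>|lborel. g \<xi> * fourier v \<xi>)"
  proof (rule Bochner_Integration.integral_cong[OF refl])
    fix \<xi> :: real
    have "?E \<xi> / (of_real \<xi> - k) + ?E \<xi> / k = ?E \<xi> * of_real \<xi> / (k * (of_real \<xi> - k))" if "0 < \<xi>"
      using diff_nz[of \<xi>] that k_nz by (simp add: divide_simps) (simp add: algebra_simps)
    then have "?I \<xi> * (?E \<xi> / (of_real \<xi> - k) + ?E \<xi> / k) = g \<xi>"
      by (cases "0 < \<xi>") (simp_all add: g_def)
    then show "?I \<xi> * (?E \<xi> / (of_real \<xi> - k)) * fourier v \<xi> + ?I \<xi> * ?E \<xi> / k * fourier v \<xi>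
        = g \<xi> * fourier v \<xi>"
      by (simp add: distrib_left distrib_right flip: \<open>_ = g \<xi>\<close>)
  qed
  also have "cmod (1 / (2 * of_real pi) * \<dots>) \<le> L / cmod k powr (1 + \<epsilon>) * H"
  proof (rule norm_fourier_integral_le(2))
    show "g \<in> borel_measurable borel" unfolding g_def by measurable
    fix \<xi> :: real
    show "cmod (g \<xi>) \<le> L / cmod k powr (1 + \<epsilon>) * weight \<xi> powr \<delta>"
    proof (cases "0 < \<xi>")
      case True
      have "cmod (g \<xi>) = \<xi> / cmod k * (1 / cmod (of_real \<xi> - k))"
        using True by (simp add: g_def norm_divide norm_mult mult.assoc norm_exp_i_times flip: of_real_mult)
      also have "\<dots> \<le> \<xi> / cmod k * (L / (\<xi> + cmod k))"
        using True by (intro mult_left_mono norm_inverse_le) auto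
      \<comment> \<open>The source of the additional decay: a ratio at most 1 grows when its
        exponent is lowered from 1 to \<epsilon>, which trades
        \<open>cmod k powr (-\<epsilon>)\<close> for \<open>weight \<xi> powr \<epsilon>\<close>;
        \<epsilon> \<le> \<delta> lets H absorb the latter.\<close>
      also have "\<dots> = L / cmod k * (\<xi> / (\<xi> + cmod k)) powr 1" using True by simp
      also have "\<dots> \<le> L / cmod k * (\<xi> / (\<xi> + cmod k)) powr \<epsilon>"
        using True Kpos L_nonneg assms by (intro mult_left_mono powr_mono') (auto simp: divide_le_eq_1 add_pos_nonneg)
      also have "\<dots> \<le> L / cmod k * (weight \<xi> / cmod k) powr \<epsilon>"
        using True Kpos L_nonneg assms
        by (intro mult_left_mono powr_mono2 frac_le) (auto simp: weight_def)
      also have "\<dots> = L / cmod k powr (1 + \<epsilon>) * weight \<xi> powr \<epsilon>"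
        using Kpos weight_ge_1[of \<xi>] by (simp add: powr_divide powr_add)
      also have "\<dots> \<le> L / cmod k powr (1 + \<epsilon>) * weight \<xi> powr \<delta>"
        using assms L_nonneg weight_ge_1[of \<xi>] by (intro mult_left_mono powr_mono) auto
      finally show ?thesis .
    qed (simp add: g_def L_nonneg)
  qed
  finally show ?thesis .
qed

end

section \<open>Existence, uniqueness and asymptotics of the Jost solution\<close>

lemma Linf_weighted_bound:
  assumes "m \<in> Linf_weighted (- d)"
  obtains A where "0 \<le> A" "AE x in lebesgue. cmod (m x) \<le> A * weight x powr d"
proof -
  let ?f = "\<lambda>x. weight x powr (- d) *\<^sub>R m x"
  have "Linf_norm ?f < \<infinity>" using assms by (simp add: Linf_weighted_def)
  then obtain r where r: "Linf_norm ?f \<le> ereal r"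
    by (cases "Linf_norm ?f") auto
  show thesis
  proof
    have "AE x in lebesgue. ereal (cmod (?f x)) \<le> Linf_norm ?f"
      unfolding Linf_norm_def by (rule esssup_AE)
    \<comment> \<open>The maximum with 0 makes the constant nonnegative without any argument about
      the sign of the essential supremum.\<close>
    then show "AE x in lebesgue. cmod (m x) \<le> max 0 r * weight x powr d"
    proof eventually_elim
      case (elim x)
      have w: "0 < weight x powr d" using weight_ge_1[of x] by simp
      from elim r have "ereal (cmod (?f x)) \<le> ereal r" by (rule order_trans)
      then have "cmod (m x) / weight x powr d \<le> max 0 r" by (simp add: powr_minus_divide)
      then show ?case using w by (simp add: field_simps)
    qed
  qed simp
qed

lemma Linf_weightedI:
  assumes [measurable]: "m \<in> borel_measurable borel" and le: "\<And>x. cmod (m x) \<le> A" and d: "0 \<le> d"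
  shows "m \<in> Linf_weighted (- d)"
proof -
  have [measurable]: "m \<in> borel_measurable lebesgue" "weight \<in> borel_measurable lebesgue"
    by (auto intro: borel_measurable_lebesgueI)
  have "esssup lebesgue (\<lambda>x. ereal (cmod (weight x powr (- d) *\<^sub>R m x))) \<le> ereal A"
  proof (rule esssup_I)
    have "cmod (weight x powr (- d) *\<^sub>R m x) \<le> A" for x
    proof -
      have "weight x powr (- d) \<le> 1"
        using one_le_weight_powr[OF d, of x] by (simp add: powr_minus_divide divide_le_eq_1)
      then have "weight x powr (- d) * cmod (m x) \<le> 1 * A"
        using le by (intro mult_mono) auto
      then show ?thesis by simp
    qed
    then show "AE x in lebesgue. ereal (cmod (weight x powr (- d) *\<^sub>R m x)) \<le> ereal A" by simp
  qed measurable
  then have "Linf_norm (\<lambda>x. weight x powr (- d) *\<^sub>R m x) < \<infinity>"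
    unfolding Linf_norm_def by (rule le_less_trans) simp
  then show ?thesis by (simp add: Linf_weighted_def)
qed

section \<open>Picard iteration for the Jost equation\<close>

context jost_operator
begin

primrec iterate :: "nat \<Rightarrow> real \<Rightarrow> complex" where
  "iterate 0 = (\<lambda>_. 0)"
| "iterate (Suc n) = (\<lambda>x. 1 + T (iterate n) x)"

lemma borel_measurable_iterate [measurable]: "iterate n \<in> borel_measurable borel"
  by (induction n) auto

context
  assumes q_le: "q \<le> 1/2"
begin

text \<open>The ball of radius 2 is invariant under the iteration because
  \<open>1 + 2 * q \<le> 2\<close>.\<close>

lemma norm_iterate_le: "cmod (iterate n x) \<le> 2"
proof (induction n arbitrary: x)
  case (Suc n)
  have "cmod (T (iterate n) x) \<le> q * 2"
    using Suc by (intro norm_T_le bounded_imp_weighted borel_measurable_lebesgueI) auto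
  then have "cmod (1 + T (iterate n) x) \<le> 1 + 1"
    using q_le by (intro norm_triangle_le) auto
  then show ?case by simp
qed simp

lemma norm_iterate_diff_le: "cmod (iterate (Suc n) x - iterate n x) \<le> (1/2) ^ n"
proof (induction n arbitrary: x)
  case 0
  have "T (\<lambda>_. 0) x = 0" by (simp add: T_def convolution_def)
  then show ?case by simp
next
  case (Suc n)
  have "iterate (Suc (Suc n)) x - iterate (Suc n) x = T (iterate (Suc n)) x - T (iterate n) x"
    by simp
  also have "\<dots> = T (\<lambda>y. iterate (Suc n) y - iterate n y) x"
    using norm_iterate_le
    by (intro T_diff bounded_imp_weighted borel_measurable_lebesgueI borel_measurable_iterate)
  also have "cmod \<dots> \<le> q * (1/2) ^ n"
    using Suc by (intro norm_T_le bounded_imp_weighted borel_measurable_lebesgueI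
        borel_measurable_diff borel_measurable_iterate) auto
  also have "\<dots> \<le> 1/2 * (1/2) ^ n" using q_le by (intro mult_right_mono) auto
  finally show ?case by simp
qed

text \<open>The increments are dominated by a geometric series, so the iterates converge at every
  point, and dominated convergence passes the equation to the limit. The fixed point is Borel and
  satisfies the equation everywhere.\<close>

lemma ex_bounded_solution:
  obtains M where "M \<in> borel_measurable borel" "\<And>x. cmod (M x) \<le> 2" "\<And>x. M x = 1 + T M x"
proof -
  \<comment> \<open>A telescoping series, equal to the limit of the iterates because
    \<open>iterate 0\<close> vanishes.\<close>
  define M where "M = (\<lambda>x. \<Sum>n. iterate (Suc n) x - iterate n x)"
  have lim: "(\<lambda>n. iterate n x) \<longlonglongrightarrow> M x" for x
  proof -
    have "summable (\<lambda>n. iterate (Suc n) x - iterate n x)"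
      by (rule summable_comparison_test'[OF summable_geometric, of "1/2" 0])
        (use norm_iterate_diff_le in auto)
    then have "(\<lambda>n. \<Sum>i<n. iterate (Suc i) x - iterate i x) \<longlonglongrightarrow> M x"
      unfolding M_def by (rule summable_LIMSEQ)
    then show ?thesis by (simp only: sum_lessThan_telescope[of "\<lambda>n. iterate n x"] iterate.simps(1) diff_zero)
  qed
  have M [measurable]: "M \<in> borel_measurable borel"
    using lim by (rule borel_measurable_LIMSEQ_metric[rotated]) measurable
  have bd: "cmod (M x) \<le> 2" for x
    using tendsto_norm[OF lim[of x]] by (rule tendsto_upperbound) (simp_all add: norm_iterate_le)
  have "M x = 1 + T M x" for x
  proof -
    let ?w = "\<lambda>y. 7 * L\<^sup>2 * cmod k powr (-1/4) * 2 * (\<bar>x - y\<bar> powr (-1/4) * (weight y powr \<delta> * cmod (v y)))"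
    have "(\<lambda>n. T (iterate n) x) \<longlonglongrightarrow> T M x"
      unfolding T_def convolution_def
    proof (rule integral_dominated_convergence)
      show "(\<lambda>y. G k (x - y) * (v y * M y)) \<in> borel_measurable lebesgue"
        "(\<lambda>y. G k (x - y) * (v y * iterate n y)) \<in> borel_measurable lebesgue" for n
        by (rule borel_measurable_lebesgueI, measurable)+
      show "integrable lebesgue ?w"
        using singular_kernel(1)[of x] by (simp add: integrable_completion)
      show "AE y in lebesgue. (\<lambda>n. G k (x - y) * (v y * iterate n y)) \<longlonglongrightarrow> G k (x - y) * (v y * M y)"
        by (intro AE_I2 tendsto_intros lim)
      show "AE y in lebesgue. norm (G k (x - y) * (v y * iterate n y)) \<le> ?w y" for n
        using norm_iterate_le
        by (intro T_dominated bounded_imp_weighted borel_measurable_lebesgueI borel_measurable_iterate)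
    qed
    then have "(\<lambda>n. iterate (Suc n) x) \<longlonglongrightarrow> 1 + T M x"
      by (simp add: tendsto_add)
    with LIMSEQ_Suc[OF lim[of x]] show ?thesis by (rule LIMSEQ_unique)
  qed
  with M bd that show thesis by blast
qed

text \<open>The difference h satisfies h = T h almost everywhere. Each application of
  \<open>T\<close> halves the constant in the growth bound, and \<open>weight \<ge> 1\<close>
  restores the weighted form; the countably many exceptional null sets are then united.\<close>

lemma solution_unique:
  assumes m: "m \<in> borel_measurable lebesgue" "AE y in lebesgue. cmod (m y) \<le> A * weight y powr \<delta>"
      "AE x in lebesgue. m x = 1 + T m x"
    and m': "m' \<in> borel_measurable lebesgue" "AE y in lebesgue. cmod (m' y) \<le> A' * weight y powr \<delta>"
      "AE x in lebesgue. m' x = 1 + T m' x"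
    and A: "0 \<le> A" "0 \<le> A'"
  shows "AE x in lebesgue. m x = m' x"
proof -
  define h where "h = (\<lambda>y. m y - m' y)"
  have [measurable]: "h \<in> borel_measurable lebesgue" using m m' by (simp add: h_def)
  have hT: "AE x in lebesgue. h x = T h x"
    using m(3) m'(3)
  proof eventually_elim
    case (elim x)
    have "h x = T m x - T m' x" using elim by (simp add: h_def)
    also have "\<dots> = T h x" unfolding h_def by (rule T_diff[OF m(1,2) m'(1,2)])
    finally show ?case .
  qed
  have "AE y in lebesgue. cmod (h y) \<le> (A + A') * (1/2) ^ n * weight y powr \<delta>" for n
  proof (induction n)
    case 0
    from m(2) m'(2) show ?case
    proof eventually_elim
      case (elim y)
      then show ?case unfolding h_def using norm_triangle_ineq4[of "m y" "m' y"] by (simp add: distrib_right)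
    qed
  next
    case (Suc n)
    have le: "cmod (T h x) \<le> q * ((A + A') * (1/2) ^ n)" for x
      using A by (intro norm_T_le Suc) auto
    from hT show ?case
    proof eventually_elim
      case (elim x)
      have "cmod (h x) = cmod (T h x)" by (rule arg_cong[OF elim])
      also have "\<dots> \<le> q * ((A + A') * (1/2) ^ n)" by (rule le)
      also have "\<dots> \<le> 1/2 * ((A + A') * (1/2) ^ n)" using q_le A by (intro mult_right_mono) auto
      also have "\<dots> * 1 \<le> 1/2 * ((A + A') * (1/2) ^ n) * weight x powr \<delta>"
        using A by (intro mult_left_mono one_le_weight_powr \<delta>_nonneg) auto
      finally show ?case by (simp add: mult_ac)
    qed
  qed
  then have "AE y in lebesgue. \<forall>n. cmod (h y) \<le> (A + A') * (1/2) ^ n * weight y powr \<delta>"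
    by (simp add: AE_all_countable)
  then show ?thesis
  proof eventually_elim
    case (elim y)
    have "(\<lambda>n. (A + A') * (1/2) ^ n * weight y powr \<delta>) \<longlonglongrightarrow> (A + A') * 0 * weight y powr \<delta>"
      by (intro tendsto_intros LIMSEQ_power_zero) auto
    then have "cmod (h y) \<le> (A + A') * 0 * weight y powr \<delta>"
      by (rule tendsto_lowerbound) (use elim in auto)
    then show ?case by (simp add: h_def)
  qed
qed

lemma is_jost_solutionD:
  assumes "is_jost_solution s s1 v k m" "s - s1 = \<delta>"
  obtains A where "m \<in> borel_measurable lebesgue" "0 \<le> A"
    "AE y in lebesgue. cmod (m y) \<le> A * weight y powr \<delta>" "AE x in lebesgue. m x = 1 + T m x"
proof -
  have m: "m \<in> Linf_weighted (- \<delta>)" "AE x in lebesgue. m x = 1 + T m x"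
    using assms by (auto simp: is_jost_solution_def T_def)
  obtain A where "0 \<le> A" "AE y in lebesgue. cmod (m y) \<le> A * weight y powr \<delta>"
    by (rule Linf_weighted_bound[OF m(1)])
  with m that show thesis by (auto simp: Linf_weighted_def)
qed

text \<open>The bounded fixed point M witnesses the predicate under the choice operator, so the
  chosen function is itself a Jost solution and uniqueness identifies it with M.\<close>

lemma jost_m1_AE_eq:
  assumes M: "M \<in> borel_measurable borel" "\<And>x. cmod (M x) \<le> 2" "\<And>x. M x = 1 + T M x"
    and \<delta>: "s - s1 = \<delta>"
  shows "(\<lambda>x. jost_m1 s s1 v x k) \<in> borel_measurable lebesgue"
    and "AE x in lebesgue. jost_m1 s s1 v x k = M x"
proof -
  let ?P = "\<lambda>m. is_jost_solution s s1 v k m \<and>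
    (\<forall>m'. is_jost_solution s s1 v k m' \<longrightarrow> (AE y in lebesgue. m' y = m y))"
  have JM: "is_jost_solution s s1 v k M"
    unfolding is_jost_solution_def \<delta>
  proof
    show "M \<in> Linf_weighted (- \<delta>)" by (rule Linf_weightedI[OF M(1,2) \<delta>_nonneg])
    show "AE x in lebesgue. M x = 1 + convolution (G k) (\<lambda>y. v y * M y) x"
      using M(3) unfolding T_def by (intro AE_I2)
  qed
  have uniq: "AE y in lebesgue. m y = m' y"
    if m: "is_jost_solution s s1 v k m" and m': "is_jost_solution s s1 v k m'" for m m'
    by (rule is_jost_solutionD[OF m \<delta>], rule is_jost_solutionD[OF m' \<delta>]) (rule solution_unique)
  define m0 where "m0 = (SOME m. ?P m)"
  have "?P M" using JM uniq by blast
  then have J0: "is_jost_solution s s1 v k m0"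
    unfolding m0_def by (rule someI[where P = ?P, THEN conjunct1])
  have e: "(\<lambda>x. jost_m1 s s1 v x k) = m0"
    by (rule ext) (simp add: jost_m1_def m0_def)
  show "(\<lambda>x. jost_m1 s s1 v x k) \<in> borel_measurable lebesgue"
    unfolding e using J0 by (simp add: is_jost_solution_def Linf_weighted_def)
  show "AE x in lebesgue. jost_m1 s s1 v x k = M x"
    using uniq[OF J0 JM] by (simp flip: e)
qed

lemma jost_m1_asymptotics:
  assumes \<delta>: "s - s1 = \<delta>" and \<epsilon>: "0 \<le> \<epsilon>" "\<epsilon> \<le> 1/4" "\<epsilon> \<le> \<delta>" and k1: "1 \<le> cmod k"
  shows "Linf_norm (\<lambda>x. jost_m1 s s1 v x k - (1 - cauchy_plus v x / k))
     \<le> ereal ((L * H + 14 * L ^ 3 * S * H) / cmod k powr (1 + \<epsilon>))"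
proof -
  obtain M where M: "M \<in> borel_measurable borel" "\<And>x. cmod (M x) \<le> 2" "\<And>x. M x = 1 + T M x"
    by (rule ex_bounded_solution) (rule that)
  define t where "t = L / cmod k * H"
  have t: "0 \<le> t" using L_nonneg H_nonneg by (simp add: t_def)
  have M1: "(\<lambda>x. M x - 1) \<in> borel_measurable lebesgue"
    using M(1) by (intro borel_measurable_lebesgueI) simp
  have split: "M x - 1 = T (\<lambda>_. 1) x + T (\<lambda>y. M y - 1) x" for x
  proof -
    have "T M x - T (\<lambda>_. 1) x = T (\<lambda>y. M y - 1) x"
      using M(1,2) by (intro T_diff[where A=2 and B=1] bounded_imp_weighted borel_measurable_lebesgueI) auto
    then show ?thesis using M(3)[of x] by (simp add: algebra_simps)
  qed
  have T_le: "cmod (T (\<lambda>y. M y - 1) x) \<le> q * A" if "\<And>x. cmod (M x - 1) \<le> A" for A x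
    using that order_trans[OF norm_ge_zero that] by (intro norm_T_le M1 bounded_imp_weighted)
  have 2: "cmod (M x - 1) \<le> 2 * t" for x
  proof -
    \<comment> \<open>The supremum is finite because M is bounded by 2. Hence
      \<open>D \<le> t + D / 2\<close> may be solved for D, giving
      \<open>D \<le> 2 * t\<close>.\<close>
    define D where "D = (SUP x. cmod (M x - 1))"
    have "cmod (M x - 1) \<le> 3" for x using norm_triangle_ineq4[of "M x" 1] M(2)[of x] by simp
    then have "bdd_above (range (\<lambda>x. cmod (M x - 1)))" by (auto intro!: bdd_aboveI)
    then have D: "cmod (M x - 1) \<le> D" for x unfolding D_def by (intro cSUP_upper) auto
    have D0: "0 \<le> D" using order_trans[OF norm_ge_zero D] .
    have "D \<le> t + q * D"
      unfolding D_def
    proof (rule cSUP_least)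
      fix x
      have "cmod (T (\<lambda>_. 1) x + T (\<lambda>y. M y - 1) x) \<le> t + q * D"
        using norm_T_one_le[of x] T_le[OF D, of x] by (intro norm_triangle_mono) (auto simp: t_def)
      then show "cmod (M x - 1) \<le> t + q * (SUP x. cmod (M x - 1))"
        using split[of x] by (simp add: D_def)
    qed simp
    also have "q * D \<le> 1/2 * D" using q_le D0 by (intro mult_right_mono)
    finally have "D \<le> 2 * t" by simp
    with D[of x] show ?thesis by linarith
  qed
  have main: "cmod (M x - (1 - cauchy_plus v x / k)) \<le> (L * H + 14 * L ^ 3 * S * H) / cmod k powr (1 + \<epsilon>)" for x
  proof -
    have "q * (2 * t) = 14 * L ^ 3 * S * H * (cmod k powr (-1/4) / cmod k)"
      by (simp add: q_def t_def power2_eq_square power3_eq_cube)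
    \<comment> \<open>The gain of one power 1/4 from \<open>q\<close> is weakened to \<epsilon>,
      using \<epsilon> \<le> 1/4 and \<open>cmod k \<ge> 1\<close>.\<close>
    also have "cmod k powr (-1/4) / cmod k \<le> cmod k powr (- \<epsilon>) / cmod k"
      using k1 \<epsilon> by (intro divide_right_mono powr_mono) auto
    also have "cmod k powr (- \<epsilon>) / cmod k = 1 / cmod k powr (1 + \<epsilon>)"
      using k_nz by (simp add: powr_add powr_minus_divide)
    finally have "q * (2 * t) \<le> 14 * L ^ 3 * S * H * (1 / cmod k powr (1 + \<epsilon>))"
      using L_nonneg S_nonneg H_nonneg by (simp add: mult_left_mono)
    moreover have "M x - (1 - cauchy_plus v x / k) = (T (\<lambda>_. 1) x + cauchy_plus v x / k) + T (\<lambda>y. M y - 1) x"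
      using split[of x] by (simp add: algebra_simps)
    ultimately show ?thesis
      using norm_T_one_add_cauchy_plus_le[of \<epsilon> x] \<epsilon> T_le[OF 2, of x]
        norm_triangle_ineq[of "T (\<lambda>_. 1) x + cauchy_plus v x / k" "T (\<lambda>y. M y - 1) x"]
      by (simp only: add_divide_distrib) simp
  qed
  have [measurable]: "cauchy_plus v \<in> borel_measurable lebesgue"
  proof (rule borel_measurable_lebesgueI)
    have "cauchy_plus v = (\<lambda>x. 1 / (2 * of_real pi) * (LINT \<xi>|lborel.
        exp (\<i> * of_real x * of_real \<xi>) * (indicator {0<..} \<xi> * fourier v \<xi>)))"
      unfolding cauchy_plus_def inverse_fourier_def by (subst integral_completion) auto
    then show "cauchy_plus v \<in> borel_measurable borel" by simp
  qed
  note [measurable] = jost_m1_AE_eq(1)[OF M \<delta>]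
  show ?thesis
    unfolding Linf_norm_def
  proof (rule esssup_I)
    show "AE x in lebesgue. ereal (cmod (jost_m1 s s1 v x k - (1 - cauchy_plus v x / k)))
        \<le> ereal ((L * H + 14 * L ^ 3 * S * H) / cmod k powr (1 + \<epsilon>))"
      using jost_m1_AE_eq(2)[OF M \<delta>] by eventually_elim (simp add: main)
  qed measurable
qed

end
end

section \<open>Independence of the representative of the potential\<close>

lemma convolution_cong_AE:
  assumes [measurable]: "f \<in> borel_measurable borel" "g \<in> borel_measurable lebesgue" "h \<in> borel_measurable lebesgue"
    and "AE y in lebesgue. g y = h y"
  shows "convolution f g = convolution f h"
proof
  fix x
  have [measurable]: "(\<lambda>y. f (x - y)) \<in> borel_measurable lebesgue"
    by (intro borel_measurable_lebesgueI) simp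
  show "convolution f g x = convolution f h x"
    unfolding convolution_def using assms(4) by (intro integral_cong_AE) auto
qed

lemma fourier_cong_AE:
  assumes [measurable]: "f \<in> borel_measurable lebesgue" "g \<in> borel_measurable lebesgue"
    and "AE x in lebesgue. f x = g x"
  shows "fourier f = fourier g"
proof
  fix \<xi>
  have [measurable]: "(\<lambda>x. exp (- (\<i> * of_real \<xi> * of_real x))) \<in> borel_measurable lebesgue"
    by (intro borel_measurable_lebesgueI) simp
  show "fourier f \<xi> = fourier g \<xi>"
    unfolding fourier_def using assms(3) by (intro integral_cong_AE) auto
qed

text \<open>Both potentials have exactly the same Jost solutions, so the choice operator returns the
  same function and equality holds at every x.\<close>

lemma jost_m1_cong_AE:
  assumes [measurable]: "G k \<in> borel_measurable borel" "f \<in> borel_measurable lebesgue" "g \<in> borel_measurable lebesgue"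
    and eq: "AE x in lebesgue. f x = g x"
  shows "jost_m1 s s1 f x k = jost_m1 s s1 g x k"
proof -
  have "convolution (G k) (\<lambda>y. f y * m y) = convolution (G k) (\<lambda>y. g y * m y)"
    if [measurable]: "m \<in> borel_measurable lebesgue" for m
    using eq by (intro convolution_cong_AE) auto
  then have "is_jost_solution s s1 f k = is_jost_solution s s1 g k"
    by (auto simp: is_jost_solution_def Linf_weighted_def fun_eq_iff)
  then show ?thesis by (simp add: jost_m1_def)
qed

theorem theorem6p4:
  fixes s s1 \<alpha> :: real and u :: "real \<Rightarrow> real"
  defines "v \<equiv> (\<lambda>x. complex_of_real (u x))"
  assumes "s > 1/2"
    and "1/2 < s1" and "s1 < s"
    and "v \<in> Hss s"
    and "0 < \<alpha>" and "\<alpha> < pi / 2"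
  shows "\<exists>\<epsilon>>0. \<exists>C::real.
    \<forall>\<^sub>F k in inf at_infinity (principal {k. \<bar>Im k\<bar> > tan \<alpha> * Re k}).
      Linf_norm (\<lambda>x. jost_m1 s s1 v x k - (1 - cauchy_plus v x / k))
        \<le> ereal (C / cmod k powr (1 + \<epsilon>))"
proof -
  define \<delta> where "\<delta> = s - s1"
  have \<delta>: "0 < \<delta>" "\<delta> < s - 1/2" "\<delta> \<le> s" using assms by (auto simp: \<delta>_def)
  have v: "v \<in> L2_weighted s" "fourier v \<in> L2_weighted s" using assms by (auto simp: Hss_def)
  have vm [measurable]: "v \<in> borel_measurable lebesgue" using v by (simp add: L2_weighted_def)
  have "(\<lambda>x. Re (v x)) \<in> borel_measurable lebesgue" by measurable
  \<comment> \<open>The measurability of parameter integrals and Fubini are applied to Borel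
    functions, so u is replaced by a Borel function equal to it almost everywhere.\<close>
  then have "u \<in> borel_measurable lebesgue" by (simp add: v_def)
  from completion_ex_borel_measurable_real[OF this]
  obtain u' where u' [measurable]: "u' \<in> borel_measurable borel" and uu': "AE x in lborel. u x = u' x"
    by auto
  define v' where "v' = (\<lambda>x. complex_of_real (u' x))"
  have v'b [measurable]: "v' \<in> borel_measurable borel" unfolding v'_def by measurable
  have v'm [measurable]: "v' \<in> borel_measurable lebesgue" by (rule borel_measurable_lebesgueI[OF v'b])
  have vv': "AE x in lebesgue. v x = v' x"
    using AE_completion[OF uu'] by eventually_elim (simp add: v_def v'_def)
  have fv: "fourier v = fourier v'" by (rule fourier_cong_AE[OF vm v'm vv'])
  then have cv: "cauchy_plus v = cauchy_plus v'" by (simp add: cauchy_plus_def)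
  have [measurable]: "weight \<in> borel_measurable lebesgue" by (simp add: borel_measurable_lebesgueI)
  note [measurable] = borel_measurable_fourier[OF v'b]
  interpret potential v' \<delta>
  proof
    have "integrable lebesgue (\<lambda>y. weight y powr \<delta> * cmod (v' y))"
      by (rule iffD1[OF integrable_cong_AE L2_weighted_integrable[OF v(1) \<delta>(2)]]) (use vv' in auto)
    then show "integrable lborel (\<lambda>y. weight y powr \<delta> * cmod (v' y))"
      by (simp add: integrable_completion)
    have "integrable lebesgue (\<lambda>y. (weight y powr \<delta> * cmod (v' y))\<^sup>2)"
      by (rule iffD1[OF integrable_cong_AE L2_weighted_integrable_square[OF v(1) \<delta>(3)]]) (use vv' in auto)
    then show "integrable lborel (\<lambda>y. (weight y powr \<delta> * cmod (v' y))\<^sup>2)"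
      by (simp add: integrable_completion)
    show "integrable lborel (\<lambda>\<xi>. weight \<xi> powr \<delta> * cmod (fourier v' \<xi>))"
      using L2_weighted_integrable[OF v(2) \<delta>(2)] by (simp add: integrable_completion fv)
  qed (use \<delta> in auto)
  define t where "t = tan \<alpha>"
  have t: "0 < t" unfolding t_def using assms by (intro tan_gt_zero) auto
  define L where "L = 3 + 2 / t"
  \<comment> \<open>\<delta> limits the decay available from the Fourier transform of u, 1/4 the
    gain from one application of \<open>T\<close>.\<close>
  define \<epsilon> where "\<epsilon> = min \<delta> (1/4)"
  define C where "C = L * H + 14 * L ^ 3 * S * H"
  \<comment> \<open>S and L do not depend on k, so \<open>q\<close> falls below 1/2 for all large
    \<open>cmod k\<close>, uniformly in the sector.\<close>
  have "((\<lambda>r. 7 * L\<^sup>2 * S * r powr (-1/4)) \<longlongrightarrow> 7 * L\<^sup>2 * S * 0) at_top"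
    by (intro tendsto_intros tendsto_neg_powr filterlim_ident) auto
  then have "eventually (\<lambda>r. 7 * L\<^sup>2 * S * r powr (-1/4) < 1/2) at_top"
    by (rule order_tendstoD(2)) simp
  then have "\<forall>\<^sub>F k :: complex in at_infinity. 7 * L\<^sup>2 * S * cmod k powr (-1/4) < 1/2"
    by (rule eventually_compose_filterlim[OF _ filterlim_norm_at_top])
  moreover have "\<forall>\<^sub>F k :: complex in at_infinity. 1 \<le> cmod k"
    by (auto simp: eventually_at_infinity)
  ultimately have "\<forall>\<^sub>F k in at_infinity. \<bar>Im k\<bar> > t * Re k \<longrightarrow>
      Linf_norm (\<lambda>x. jost_m1 s s1 v x k - (1 - cauchy_plus v x / k)) \<le> ereal (C / cmod k powr (1 + \<epsilon>))"
  proof eventually_elim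
    case (elim k)
    show ?case
    proof
      assume k: "\<bar>Im k\<bar> > t * Re k"
      interpret jost_operator k L v' \<delta>
      proof
        show "k \<noteq> 0" using elim by auto
        show "1 \<le> L" using t by (simp add: L_def)
      qed (use sector_resolvent_bound[OF t k] in \<open>simp add: L_def\<close>)
      have "q \<le> 1/2" using elim by (simp add: q_def)
      then have "Linf_norm (\<lambda>x. jost_m1 s s1 v' x k - (1 - cauchy_plus v' x / k))
          \<le> ereal (C / cmod k powr (1 + \<epsilon>))"
        unfolding C_def using elim \<delta> by (intro jost_m1_asymptotics) (auto simp: \<epsilon>_def \<delta>_def min_def)
      then show "Linf_norm (\<lambda>x. jost_m1 s s1 v x k - (1 - cauchy_plus v x / k))
          \<le> ereal (C / cmod k powr (1 + \<epsilon>))"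
        by (simp add: cv jost_m1_cong_AE[OF borel_measurable_G vm v'm vv'])
    qed
  qed
  then show ?thesis
    using \<delta> by (intro exI[of _ \<epsilon>] conjI exI[of _ C])
      (auto simp: eventually_inf_principal \<epsilon>_def t_def)
qed

end
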